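(* Consider an accelerated segment $\rho_{i,j} \in \rho_i^A$ of a task $\tau_i \in \Gamma$, and let $l_{i,x} = \mathcal{Q}(\rho_{i,j})$ be the corresponding suspension region of the self-suspending task $\tau^{\mathrm{ss}}_i$ matching $\tau_i$. Assume that $R_h \le D_h$ holds for every $\tau_h \in hp(\tau_i)$. Then, if the hardware accelerator $\mathcal{H}$ is scheduled by non-preemptive fixed-priority scheduling, the duration of $l_{i,x}$ is bounded by $S_{i,x} = \Phi_{i,x} + E_{i,j}(\mathcal{H})$, where $\Phi_{i,x}$ is the least positive solution of the equation $$\Phi_{i,x} = B_i + \sum_{\tau_h \in hp(\tau_i)} \left\lceil \frac{\Phi_{i,x} + D_h - G_h}{T_h} \right\rceil G_h ,$$ where $$B_i = \max\left\{ E_{l,v}(\mathcal{H}) \;\middle|\; \tau_l \in lp(\tau_i) \wedge \rho_{l,v} \in \rho_l^A \right\}, \qquad G_h = \sum_{\rho_{h,u} \in \rho_h^A} E_{h,u}(\mathcal{H}).$$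
   Context: Platform and tasks. The platform has a set of processor cores $p_1,\dots,p_m$ and a single hardware accelerator $\mathcal{H}$. The application is a finite set $\Gamma = \{\tau_1,\dots,\tau_n\}$ of periodic real-time tasks; each task $\tau_i$ is statically allocated to one core and has a unique fixed priority $\pi_i$; each core uses preemptive fixed-priority scheduling. $hp(\tau_i)$ (resp. $lp(\tau_i)$) is the set of all tasks in $\Gamma$, on any core, with priority higher (resp. lower) than $\pi_i$. Task $\tau_i$ releases jobs with period $T_i$, each job having to complete within a relative deadline $D_i \le T_i$ from its release; $R_i$ denotes an upper bound on the worst-case response time of $\tau_i$ (the longest time between the release and the completion of any of its jobs). Each task $\tau_i$ is a finite sequence $\rho_i = \{\rho_{i,1},\dots,\rho_{i,w}\}$ of code segments, executed sequentially: a segment $\rho_{i,j}$, $j>1$, of a job starts only after the completion of $\rho_{i,j-1}$. Each segment is either accelerated or not; $\rho_i^A \subseteq \rho_i$ is the set of accelerated segments of $\tau_i$. Offloading (synchronous, suspension-based). A non-accelerated segment consists only of a processing (execution) phase on the core $p_k$ of its task, with worst-case execution time (WCET) $E_{i,j}(p_k)$. An accelerated segment $\rho_{i,j}$ of a task on core $p_k$ first executes an offloading phase on $p_k$ (WCET $O_{i,j}(p_k)$); upon its completion the task suspends on $p_k$ and the processing (execution) phase is requested on, and runs on, $\mathcal{H}$ (WCET $E_{i,j}(\mathcal{H})$); when this completes, the task is awakened on $p_k$ and executes a finalization phase (WCET $F_{i,j}(p_k)$), which terminates the segment. Matching self-suspending task. The task $\tau_i$ on $p_k$ is mapped to a self-suspending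 task $\tau^{\mathrm{ss}}_i$, i.e., an ordered sequence of regions $l_{i,1}, l_{i,2},\dots$ alternating between execution and suspension regions: each non-accelerated segment is mapped to an execution region; for each accelerated segment, the offloading phase is mapped to an execution region, the processing phase on $\mathcal{H}$ to a suspension region, and the finalization phase to an execution region; consecutive execution regions are merged. $\mathcal{Q}(\rho_{i,j})$ denotes the suspension region corresponding to accelerated segment $\rho_{i,j}$. Its duration is the response time of the processing phase on the accelerator, i.e., the time from when the task suspends on its core to request acceleration until the completion of the processing phase on $\mathcal{H}$. Non-preemptive fixed-priority on the accelerator. The processing phase of each accelerated segment is scheduled on $\mathcal{H}$ with the same priority as the corresponding task and, once started, is executed to completion without preemption. The maximum over an empty set is understood to be $0$. *)

theory Defs
  imports "HOL-Analysis.Analysis"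
begin

text \<open>
  The type parameter \<open>'p\<close> is the type of core names. Segments are indexed from \<open>0\<close>, and a larger
  number is a higher priority. All tasks have different priorities, so distinct tasks are distinct
  records and an application can be a plain set of records.
\<close>

datatype 'p segment =
    Plain "'p \<Rightarrow> real"  \<comment> \<open>WCET on each core\<close>
  | Accelerated "'p \<Rightarrow> real" real "'p \<Rightarrow> real"
      \<comment> \<open>WCETs of offloading (per core), processing on the accelerator, finalization (per core)\<close>

record 'p task =
  segs :: "'p segment list"
  period :: real
  deadline :: real
  prio :: nat
  core :: 'p

definition hp :: "'p task set \<Rightarrow> 'p task \<Rightarrow> 'p task set" where
  "hp \<Gamma> \<tau> = {\<tau>' \<in> \<Gamma>. prio \<tau>' > prio \<tau>}"

definition lp :: "'p task set \<Rightarrow> 'p task \<Rightarrow> 'p task set" where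
  "lp \<Gamma> \<tau> = {\<tau>' \<in> \<Gamma>. prio \<tau>' < prio \<tau>}"

definition accel_segs :: "'p task \<Rightarrow> nat set" where
  "accel_segs \<tau> = {j. j < length (segs \<tau>) \<and> (\<exists>O' E F. segs \<tau> ! j = Accelerated O' E F)}"

text \<open>The argument of a phase is the index of its segment.\<close>

datatype phase = Exec nat | Offload nat | Process nat | Finalize nat

fun on_accel :: "phase \<Rightarrow> bool" where
  "on_accel (Process j) = True"
| "on_accel _ = False"

text \<open>Only the pairs of phase and segment kind that occur in a task matter; the rest is \<open>0\<close>.\<close>

fun segment_wcet :: "'p segment \<Rightarrow> 'p \<Rightarrow> phase \<Rightarrow> real" where
  "segment_wcet (Plain E) p (Exec _) = E p"
| "segment_wcet (Accelerated O' E F) p (Offload _) = O' p"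
| "segment_wcet (Accelerated O' E F) p (Process _) = E"
| "segment_wcet (Accelerated O' E F) p (Finalize _) = F p"
| "segment_wcet _ _ _ = 0"

fun seg_index :: "phase \<Rightarrow> nat" where
  "seg_index (Exec j) = j"
| "seg_index (Offload j) = j"
| "seg_index (Process j) = j"
| "seg_index (Finalize j) = j"

definition wcet :: "'p task \<Rightarrow> phase \<Rightarrow> real" where
  "wcet \<tau> ph = segment_wcet (segs \<tau> ! seg_index ph) (core \<tau>) ph"

abbreviation accel_wcet :: "'p task \<Rightarrow> nat \<Rightarrow> real" where
  "accel_wcet \<tau> j \<equiv> wcet \<tau> (Process j)"

fun segment_phases :: "'p segment \<Rightarrow> nat \<Rightarrow> phase list" where
  "segment_phases (Plain _) j = [Exec j]"
| "segment_phases (Accelerated _ _ _) j = [Offload j, Process j, Finalize j]"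

definition phases :: "'p task \<Rightarrow> phase list" where
  "phases \<tau> = concat (map (\<lambda>j. segment_phases (segs \<tau> ! j) j) [0..<length (segs \<tau>)])"

fun positive_segment :: "'p set \<Rightarrow> 'p segment \<Rightarrow> bool" where
  "positive_segment P (Plain E) \<longleftrightarrow> (\<forall>p\<in>P. 0 < E p)"
| "positive_segment P (Accelerated O' E F) \<longleftrightarrow> 0 < E \<and> (\<forall>p\<in>P. 0 < O' p \<and> 0 < F p)"

definition task_system :: "'p set \<Rightarrow> 'p task set \<Rightarrow> bool" where
  "task_system P \<Gamma> \<longleftrightarrow> finite P \<and> finite \<Gamma> \<and> inj_on prio \<Gamma> \<and>
     (\<forall>\<tau>\<in>\<Gamma>. core \<tau> \<in> P \<and> 0 < deadline \<tau> \<and> deadline \<tau> \<le> period \<tau> \<and> segs \<tau> \<noteq> [] \<and>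
        (\<forall>s\<in>set (segs \<tau>). positive_segment P s))"

datatype region = Execution "phase list" | Suspension nat

fun merge_phases :: "phase list \<Rightarrow> region list" where
  "merge_phases [] = []"
| "merge_phases (Process j # phs) = Suspension j # merge_phases phs"
| "merge_phases (ph # phs) =
     (case merge_phases phs of
        Execution es # rs \<Rightarrow> Execution (ph # es) # rs
      | rs \<Rightarrow> Execution [ph] # rs)"

definition ss_task :: "'p task \<Rightarrow> region list" where
  "ss_task \<tau> = merge_phases (phases \<tau>)"

definition Q_region :: "nat \<Rightarrow> region" where
  "Q_region j = Suspension j"

text \<open>
  A schedule fixes the first release of each task, the actual duration of each phase of each job,
  and the set of instants at which each phase of each job executes. Jobs are numbered from \<open>0\<close>.
\<close>

record 'p schedule =
  offset :: "'p task \<Rightarrow> real"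
  actual :: "'p task \<Rightarrow> nat \<Rightarrow> phase \<Rightarrow> real"
  runs :: "'p task \<Rightarrow> nat \<Rightarrow> phase \<Rightarrow> real set"

definition release :: "'p schedule \<Rightarrow> 'p task \<Rightarrow> nat \<Rightarrow> real" where
  "release \<sigma> \<tau> k = offset \<sigma> \<tau> + real k * period \<tau>"

definition completed :: "'p schedule \<Rightarrow> 'p task \<Rightarrow> nat \<Rightarrow> phase \<Rightarrow> real \<Rightarrow> bool" where
  "completed \<sigma> \<tau> k ph t \<longleftrightarrow> actual \<sigma> \<tau> k ph \<le> measure lebesgue (runs \<sigma> \<tau> k ph \<inter> {..t})"

definition job_completed :: "'p schedule \<Rightarrow> 'p task \<Rightarrow> nat \<Rightarrow> real \<Rightarrow> bool" where
  "job_completed \<sigma> \<tau> k t \<longleftrightarrow> (\<forall>ph\<in>set (phases \<tau>). completed \<sigma> \<tau> k ph t)"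

text \<open>
  The phases of a job execute in order, and a task is sequential: a job does not start before the
  previous job of the same task has completed.
\<close>

definition ready :: "'p schedule \<Rightarrow> 'p task \<Rightarrow> nat \<Rightarrow> phase \<Rightarrow> real \<Rightarrow> bool" where
  "ready \<sigma> \<tau> k ph t \<longleftrightarrow> release \<sigma> \<tau> k \<le> t \<and>
     (\<forall>k'<k. job_completed \<sigma> \<tau> k' t) \<and>
     (\<forall>ph'\<in>set (takeWhile (\<lambda>q. q \<noteq> ph) (phases \<tau>)). completed \<sigma> \<tau> k ph' t)"

definition pending :: "'p schedule \<Rightarrow> 'p task \<Rightarrow> nat \<Rightarrow> phase \<Rightarrow> real \<Rightarrow> bool" where
  "pending \<sigma> \<tau> k ph t \<longleftrightarrow> ready \<sigma> \<tau> k ph t \<and> \<not> completed \<sigma> \<tau> k ph t"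

definition core_phases :: "'p task \<Rightarrow> phase set" where
  "core_phases \<tau> = {ph \<in> set (phases \<tau>). \<not> on_accel ph}"

text \<open>
  Every phase takes positive time, up to its WCET. With offloading phases of length \<open>0\<close> a request
  could coincide with the release of its job, and ties at the end of an analysed busy interval
  would matter.
\<close>

definition valid_durations :: "'p task set \<Rightarrow> 'p schedule \<Rightarrow> bool" where
  "valid_durations \<Gamma> \<sigma> \<longleftrightarrow>
     (\<forall>\<tau>\<in>\<Gamma>. \<forall>k. \<forall>ph\<in>set (phases \<tau>).
        0 < actual \<sigma> \<tau> k ph \<and> actual \<sigma> \<tau> k ph \<le> wcet \<tau> ph \<and>
        runs \<sigma> \<tau> k ph \<in> sets lebesgue)"

text \<open>
  A task with a processing phase requested or running on the accelerator has no pending core phase,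
  hence it is suspended on its core.
\<close>

definition preemptive_fp :: "'p task set \<Rightarrow> 'p schedule \<Rightarrow> bool" where
  "preemptive_fp \<Gamma> \<sigma> \<longleftrightarrow>
     (\<forall>\<tau>\<in>\<Gamma>. \<forall>k. \<forall>ph\<in>core_phases \<tau>. \<forall>t.
        t \<in> runs \<sigma> \<tau> k ph \<longleftrightarrow>
          pending \<sigma> \<tau> k ph t \<and>
          (\<forall>\<tau>'\<in>hp \<Gamma> \<tau>. core \<tau>' = core \<tau> \<longrightarrow>
             (\<forall>k'. \<forall>ph'\<in>core_phases \<tau>'. \<not> pending \<sigma> \<tau>' k' ph' t)))"

text \<open>
  The four requirements: non-preemption (the run set is empty when the phase never starts), fixed
  priority at the start instant, mutual exclusion, and work conservation.
\<close>

definition nonpreemptive_fp :: "'p task set \<Rightarrow> 'p schedule \<Rightarrow> bool" where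
  "nonpreemptive_fp \<Gamma> \<sigma> \<longleftrightarrow>
     (\<forall>\<tau>\<in>\<Gamma>. \<forall>k. \<forall>j\<in>accel_segs \<tau>.
        runs \<sigma> \<tau> k (Process j) = {} \<or>
        (\<exists>s. runs \<sigma> \<tau> k (Process j) = {s..<s + actual \<sigma> \<tau> k (Process j)} \<and>
             pending \<sigma> \<tau> k (Process j) s \<and>
             (\<forall>\<tau>'\<in>hp \<Gamma> \<tau>. \<forall>k'. \<forall>j'\<in>accel_segs \<tau>'. \<not> pending \<sigma> \<tau>' k' (Process j') s))) \<and>
     (\<forall>\<tau>\<in>\<Gamma>. \<forall>k. \<forall>j\<in>accel_segs \<tau>. \<forall>\<tau>'\<in>\<Gamma>. \<forall>k'. \<forall>j'\<in>accel_segs \<tau>'.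
        (\<tau>, k, j) \<noteq> (\<tau>', k', j') \<longrightarrow>
        runs \<sigma> \<tau> k (Process j) \<inter> runs \<sigma> \<tau>' k' (Process j') = {}) \<and>
     (\<forall>\<tau>\<in>\<Gamma>. \<forall>k. \<forall>j\<in>accel_segs \<tau>. \<forall>t. pending \<sigma> \<tau> k (Process j) t \<longrightarrow>
        (\<exists>\<tau>'\<in>\<Gamma>. \<exists>k'. \<exists>j'\<in>accel_segs \<tau>'. t \<in> runs \<sigma> \<tau>' k' (Process j')))"

definition legal :: "'p task set \<Rightarrow> 'p schedule \<Rightarrow> bool" where
  "legal \<Gamma> \<sigma> \<longleftrightarrow> valid_durations \<Gamma> \<sigma> \<and> preemptive_fp \<Gamma> \<sigma> \<and> nonpreemptive_fp \<Gamma> \<sigma>"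

text \<open>Instants and durations are extended reals; what never completes does so at \<open>\<infinity>\<close>.\<close>

definition finish_time :: "'p schedule \<Rightarrow> 'p task \<Rightarrow> nat \<Rightarrow> phase \<Rightarrow> ereal" where
  "finish_time \<sigma> \<tau> k ph = Inf {ereal t | t. completed \<sigma> \<tau> k ph t}"

definition response_time :: "'p schedule \<Rightarrow> 'p task \<Rightarrow> nat \<Rightarrow> ereal" where
  "response_time \<sigma> \<tau> k = Inf {ereal t | t. job_completed \<sigma> \<tau> k t} - ereal (release \<sigma> \<tau> k)"

definition wcrt :: "'p task set \<Rightarrow> 'p task \<Rightarrow> ereal" where
  "wcrt \<Gamma> \<tau> = Sup {response_time \<sigma> \<tau> k | \<sigma> k. legal \<Gamma> \<sigma>}"

text \<open>
  The duration of an execution region is the processor time it takes; that of a suspension region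
  is the time from the suspension of the task to the completion of the processing phase.
\<close>

fun region_duration :: "'p schedule \<Rightarrow> 'p task \<Rightarrow> nat \<Rightarrow> region \<Rightarrow> ereal" where
  "region_duration \<sigma> \<tau> k (Execution phs) = ereal (sum_list (map (actual \<sigma> \<tau> k) phs))"
| "region_duration \<sigma> \<tau> k (Suspension j) =
     finish_time \<sigma> \<tau> k (Process j) - finish_time \<sigma> \<tau> k (Offload j)"

definition blocking :: "'p task set \<Rightarrow> 'p task \<Rightarrow> real" where
  "blocking \<Gamma> \<tau> =
     (let A = {accel_wcet \<tau>' v | \<tau>' v. \<tau>' \<in> lp \<Gamma> \<tau> \<and> v \<in> accel_segs \<tau>'}
      in if A = {} then 0 else Max A)"

definition accel_demand :: "'p task \<Rightarrow> real" where
  "accel_demand \<tau> = (\<Sum>u\<in>accel_segs \<tau>. accel_wcet \<tau> u)"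

definition least_positive_solution :: "(real \<Rightarrow> bool) \<Rightarrow> real \<Rightarrow> bool" where
  "least_positive_solution eq \<phi> \<longleftrightarrow> 0 < \<phi> \<and> eq \<phi> \<and> (\<forall>y. 0 < y \<and> eq y \<longrightarrow> \<phi> \<le> y)"

end

theory Submission
  imports Defs
begin

text \<open>
  At any time \<open>r\<close> at which the offloading phase is complete, the processing phase starts by
  \<open>r + \<Phi>\<close>. Otherwise the accelerator serves other phases throughout \<open>{r..r + \<Phi>}\<close>, and, since runs
  are right-open intervals, up to \<open>r + \<Phi> + d\<close> for every small \<open>d > 0\<close>. In this window at most one
  lower-priority phase runs, namely one that started before \<open>r\<close>, and it contributes at most the
  blocking term. A job of a higher-priority task \<open>h\<close> completes within \<open>deadline h\<close> of its release,
  so the jobs of \<open>h\<close> contribute at most the ceiling term for a window of length \<open>\<Phi>\<close>; the extra \<open>d\<close>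
  is compensated by the positive length of the offloading phases. Hence \<open>\<Phi> + d \<le> \<Phi>\<close>, a
  contradiction.

  The workload bound needs \<open>accel_demand h \<le> deadline h\<close>. Since \<open>wcrt\<close> is a supremum over legal
  schedules, this requires a legal schedule in which one job of \<open>h\<close> takes longer than the deadline
  if the demand is larger. Such a schedule is built from offsets for which no two jobs are ever
  released simultaneously.
\<close>

section \<open>Workload of a periodic task\<close>

text \<open>Job \<open>n\<close> is released at \<open>a + real n * T\<close> and gets service
  \<open>w n\<close> in a window of length \<open>L\<close> from \<open>r\<close>. If the first and
  the last job relevant to the window are \<open>m\<close> periods apart, \<open>L + D - G\<close>
  equals \<open>m * T + (u + v) - G\<close>, where \<open>u\<close> and \<open>v\<close> bound the
  service of these two jobs. Either \<open>u + v\<close> exceeds \<open>G\<close> and the ceiling is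
  at least \<open>m + 1\<close>, or the two outer jobs together get at most \<open>G\<close> and a
  ceiling of \<open>m\<close> suffices.\<close>

lemma sum_periodic_contributions_le:
  fixes w :: "nat \<Rightarrow> real" and a T D G r L :: real
  assumes "finite N" and "0 \<le> G" "G \<le> D" "D \<le> T" "0 < T" "0 < L"
    and w_le: "\<And>n. n \<in> N \<Longrightarrow> w n \<le> G"
      "\<And>n. n \<in> N \<Longrightarrow> w n \<le> max 0 (a + real n * T + D - r)"
      "\<And>n. n \<in> N \<Longrightarrow> w n \<le> max 0 (r + L - (a + real n * T))"
  shows "sum w N \<le> real_of_int \<lceil>(L + D - G) / T\<rceil> * G"
proof -
  define M where "M = {n \<in> N. r - D < a + real n * T \<and> a + real n * T < r + L}"
  have "finite M" "M \<subseteq> N" using \<open>finite N\<close> by (auto simp: M_def)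
  have le0: "w n \<le> 0" if "n \<in> N - M" for n
    using that w_le(2)[of n] w_le(3)[of n] by (auto simp: M_def)
  have "sum w N = sum w M + sum w (N - M)"
    using \<open>finite N\<close> \<open>M \<subseteq> N\<close> by (metis add.commute sum.subset_diff)
  also have "\<dots> \<le> sum w M" using sum_nonpos[of "N - M" w] le0 by simp
  finally have sumN: "sum w N \<le> sum w M" .
  let ?C = "real_of_int \<lceil>(L + D - G) / T\<rceil>"
  show ?thesis
  proof (cases "M = {}")
    case True
    have "0 < (L + D - G) / T" using assms by simp
    then have "0 \<le> ?C" by linarith
    with True sumN \<open>0 \<le> G\<close> show ?thesis by (simp add: order_trans[OF _ mult_nonneg_nonneg])
  next
    case False
    define p q where "p = Min M" and "q = Max M"
    have pq: "p \<in> M" "q \<in> M" "p \<le> q" "M \<subseteq> {p..q}"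
      using False \<open>finite M\<close> by (auto simp: p_def q_def)
    define m where "m = q - p"
    have q_eq: "real q = real p + real m" using pq by (simp add: m_def)
    define u v where "u = a + real p * T + D - r" and "v = r + L - (a + real q * T)"
    have uv: "0 < u" "0 < v" using pq by (auto simp: u_def v_def M_def)
    have eq: "(L + D - G) / T = real m + (u + v - G) / T"
      using \<open>0 < T\<close> by (simp add: u_def v_def q_eq field_simps)
    have C_eq: "?C = real m + real_of_int \<lceil>(u + v - G) / T\<rceil>"
      using ceiling_add_of_int[of "(u + v - G) / T" "int m"] unfolding eq by (simp add: add.commute)
    have cardM: "real (card M) \<le> real m + 1"
      using card_mono[OF _ pq(4)] pq(3) by (simp add: m_def)
    show ?thesis
    proof (cases "G < u + v")
      case True
      have "0 < (u + v - G) / T" using True \<open>0 < T\<close> by simp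
      then have "1 \<le> \<lceil>(u + v - G) / T\<rceil>" by (simp add: int_one_le_iff_zero_less)
      then have "real m + 1 \<le> ?C" unfolding C_eq by simp
      have "sum w M \<le> real (card M) * G"
        using sum_bounded_above[of M w G] w_le(1) \<open>M \<subseteq> N\<close> by auto
      also have "\<dots> \<le> (real m + 1) * G" using cardM \<open>0 \<le> G\<close> by (rule mult_right_mono)
      also have "\<dots> \<le> ?C * G" using \<open>real m + 1 \<le> ?C\<close> \<open>0 \<le> G\<close> by (rule mult_right_mono)
      finally show ?thesis using sumN by simp
    next
      case False
      \<comment> \<open>A single relevant job would give \<open>u + v = L + D\<close>, which exceeds
        \<open>G\<close>. So the first and the last job differ and can be split off the sum
        separately.\<close>
      have "u + v = L + D - real m * T" by (simp add: u_def v_def q_eq field_simps)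
      with False assms have "m \<noteq> 0" by (intro notI) auto
      then have "p \<noteq> q" by (auto simp: m_def)
      \<comment> \<open>Here \<open>G \<le> D \<le> T\<close> enters: the negative correction stays
        below one period, so the ceiling does not drop below \<open>m\<close>.\<close>
      have "- 1 < (u + v - G) / T" using uv assms by (simp add: field_simps)
      then have "0 \<le> \<lceil>(u + v - G) / T\<rceil>" by (simp add: zero_le_ceiling)
      then have C: "real m \<le> ?C" unfolding C_eq by simp
      have "sum w M = w p + w q + sum w (M - {p, q})"
        using \<open>finite M\<close> pq \<open>p \<noteq> q\<close>
        by (simp add: sum.remove[of M p] sum.remove[of "M - {p}" q] Diff_insert2[symmetric])
      also have "\<dots> \<le> u + v + real (card (M - {p, q})) * G"
        using w_le(2)[of p] w_le(3)[of q] pq uv \<open>M \<subseteq> N\<close> sum_bounded_above[of "M - {p,q}" w G] w_le(1)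
        by (intro add_mono) (auto simp: u_def v_def subset_iff)
      also have "\<dots> \<le> G + (real m - 1) * G"
      proof (intro add_mono mult_right_mono)
        have "card (M - {p, q}) = card M - 2"
          using pq \<open>p \<noteq> q\<close> \<open>finite M\<close> by (simp add: card_Diff_subset)
        then show "real (card (M - {p, q})) \<le> real m - 1" using cardM \<open>m \<noteq> 0\<close> by linarith
      qed (use False \<open>0 \<le> G\<close> in auto)
      also have "\<dots> \<le> ?C * G" using mult_right_mono[OF C \<open>0 \<le> G\<close>] by (simp add: algebra_simps)
      finally show ?thesis using sumN by simp
    qed
  qed
qed

lemma finite_arith_progression_less:
  fixes a T c :: real
  assumes "0 < T"
  shows "finite {n. a + real n * T < c}"
proof -
  have "n \<le> nat \<lceil>(c - a) / T\<rceil>" if "a + real n * T < c" for n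
  proof -
    have "real n \<le> (c - a) / T" using that assms by (simp add: field_simps)
    then show ?thesis by linarith
  qed
  then have "{n. a + real n * T < c} \<subseteq> {..nat \<lceil>(c - a) / T\<rceil>}" by auto
  then show ?thesis by (rule finite_subset) simp
qed

section \<open>Phases and segments\<close>

text \<open>The predecessors of a phase are encoded by \<open>takeWhile\<close>; this is totality of
  the precedence order so encoded.\<close>

lemma takeWhile_neq_cases:
  assumes "x \<in> set xs" "y \<in> set xs" "x \<noteq> y"
  shows "x \<in> set (takeWhile (\<lambda>z. z \<noteq> y) xs) \<or> y \<in> set (takeWhile (\<lambda>z. z \<noteq> x) xs)"
  using assms
proof (induction xs)
  case (Cons a xs)
  then show ?case by (cases "x = a"; cases "y = a") auto
qed simp

lemma seg_index_segment_phases: "ph \<in> set (segment_phases s j) \<Longrightarrow> seg_index ph = j"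
  by (cases s) auto

lemma distinct_phases: "distinct (phases \<tau>)"
proof -
  let ?f = "\<lambda>j. segment_phases (segs \<tau> ! j) j"
  have "distinct (concat (map ?f [0..<n]))" for n
  proof (induction n)
    case (Suc n)
    have "distinct (?f n)" by (cases "segs \<tau> ! n") auto
    with Suc show ?case by (fastforce dest: seg_index_segment_phases)
  qed simp
  then show ?thesis by (simp add: phases_def)
qed

lemma phases_nonempty:
  fixes \<tau> :: "'p task"
  assumes "task_system P \<Gamma>" "\<tau> \<in> \<Gamma>"
  shows "phases \<tau> \<noteq> []"
proof -
  have "segs \<tau> \<noteq> []" using assms by (simp add: task_system_def)
  moreover have "segment_phases s j \<noteq> []" for s :: "'p segment" and j by (cases s) auto
  ultimately show ?thesis by (auto simp: phases_def)
qed

lemma set_phases: "set (phases \<tau>) = (\<Union>j<length (segs \<tau>). set (segment_phases (segs \<tau> ! j) j))"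
  by (auto simp: phases_def)

lemma Process_in_phases:
  fixes \<tau> :: "'a task"
  shows "Process j \<in> set (phases \<tau>) \<longleftrightarrow> j \<in> accel_segs \<tau>"
proof -
  have "Process j \<in> set (segment_phases s i) \<longleftrightarrow> i = j \<and> (\<exists>O' E F. s = Accelerated O' E F)" for s :: "'a segment" and i
    by (cases s) auto
  then show ?thesis by (auto simp: set_phases accel_segs_def)
qed

lemma phases_split_at_accel:
  assumes "j \<in> accel_segs \<tau>"
  obtains xs ys where "phases \<tau> = xs @ Offload j # Process j # ys"
proof -
  obtain O' E F where j: "j < length (segs \<tau>)" "segs \<tau> ! j = Accelerated O' E F"
    using assms by (auto simp: accel_segs_def)
  then have "[0..<length (segs \<tau>)] = [0..<j] @ j # [Suc j..<length (segs \<tau>)]"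
    by (metis upt_add_eq_append upt_conv_Cons le_add_diff_inverse less_imp_le_nat zero_le)
  then show thesis using that j by (simp add: phases_def)
qed

lemma takeWhile_neq_distinct:
  "distinct (xs @ y # ys) \<Longrightarrow> takeWhile (\<lambda>z. z \<noteq> y) (xs @ y # ys) = xs"
  by (auto simp: takeWhile_append)

lemma Offload_in_phases: "j \<in> accel_segs \<tau> \<Longrightarrow> Offload j \<in> set (phases \<tau>)"
  by (erule phases_split_at_accel) simp

text \<open>\<open>Offload j\<close> stands immediately before \<open>Process j\<close>. Thus
  readiness for processing differs from readiness for offloading just by the completion of the
  offloading phase.\<close>

lemma takeWhile_Process:
  assumes "j \<in> accel_segs \<tau>"
  shows "set (takeWhile (\<lambda>q. q \<noteq> Process j) (phases \<tau>)) =
    insert (Offload j) (set (takeWhile (\<lambda>q. q \<noteq> Offload j) (phases \<tau>)))"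
proof -
  obtain xs ys where eq: "phases \<tau> = xs @ Offload j # Process j # ys"
    using assms by (rule phases_split_at_accel)
  show ?thesis
    using distinct_phases[of \<tau>] takeWhile_neq_distinct[of xs "Offload j" "Process j # ys"]
      takeWhile_neq_distinct[of "xs @ [Offload j]" "Process j" ys] by (simp add: eq)
qed

lemma finite_accel_segs [simp]: "finite (accel_segs \<tau>)"
  by (simp add: accel_segs_def)

lemma wcet_pos:
  assumes "task_system P \<Gamma>" "\<tau> \<in> \<Gamma>" "ph \<in> set (phases \<tau>)"
  shows "0 < wcet \<tau> ph"
proof -
  obtain j where j: "j < length (segs \<tau>)" "ph \<in> set (segment_phases (segs \<tau> ! j) j)"
    using assms(3) by (auto simp: set_phases)
  have "positive_segment P (segs \<tau> ! j)" "core \<tau> \<in> P"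
    using assms(1,2) j(1) by (auto simp: task_system_def)
  with j(2) show ?thesis
    by (cases "segs \<tau> ! j") (auto simp: wcet_def)
qed

section \<open>Legal schedules\<close>

text \<open>\<open>measure\<close> is 0 on sets of infinite measure, so finiteness is recorded along
  with the bound. The maximum covers \<open>b < a\<close>, where \<open>A\<close> is empty.\<close>

lemma measure_le_of_subset_Icc:
  fixes A :: "real set"
  assumes "A \<in> sets lebesgue" "A \<subseteq> {a..b}"
  shows "A \<in> fmeasurable lebesgue" and "measure lebesgue A \<le> max 0 (b - a)"
proof -
  have I: "{a..b} \<in> fmeasurable lebesgue" using lmeasurable_cbox[of a b] by (simp add: cbox_interval)
  show "A \<in> fmeasurable lebesgue" by (rule fmeasurableI2[OF I assms(2,1)])
  have "measure lebesgue A \<le> measure lebesgue {a..b}"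
    by (rule measure_mono_fmeasurable[OF assms(2,1) I])
  then show "measure lebesgue A \<le> max 0 (b - a)" by (auto simp: max_def split: if_splits)
qed

lemma Ico_lmeasurable: "{a..<b::real} \<in> fmeasurable lebesgue"
  by (rule measure_le_of_subset_Icc(1)[of _ a b]) auto

lemma obtain_pos_lower_bound:
  fixes f :: "'b \<Rightarrow> real"
  assumes "finite A" "\<And>x. x \<in> A \<Longrightarrow> 0 < f x" "0 < c"
  obtains d where "0 < d" "d \<le> c" "\<And>x. x \<in> A \<Longrightarrow> d \<le> f x"
\<comment> \<open>Inserting \<open>c\<close> caps the minimum and keeps the set nonempty when
  \<open>A\<close> is empty.\<close>
proof (rule that[of "Min (insert c (f ` A))"])
  show "0 < Min (insert c (f ` A))" using assms by (subst Min_gr_iff) auto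
qed (use assms in auto)

lemma accel_wcet_le_blocking:
  assumes "finite \<Gamma>" "\<tau>' \<in> lp \<Gamma> \<tau>" "v \<in> accel_segs \<tau>'"
  shows "accel_wcet \<tau>' v \<le> blocking \<Gamma> \<tau>"
proof -
  let ?A = "{accel_wcet \<tau>' v | \<tau>' v. \<tau>' \<in> lp \<Gamma> \<tau> \<and> v \<in> accel_segs \<tau>'}"
  have "?A = (\<Union>\<tau>'\<in>lp \<Gamma> \<tau>. accel_wcet \<tau>' ` accel_segs \<tau>')" by auto
  moreover have "finite (lp \<Gamma> \<tau>)" using assms(1) by (simp add: lp_def)
  ultimately have "finite ?A" by simp
  moreover have "accel_wcet \<tau>' v \<in> ?A" using assms by blast
  ultimately show ?thesis unfolding blocking_def Let_def by (auto intro!: Max_ge)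
qed

lemma accel_wcet_pos:
  assumes "task_system P \<Gamma>" "\<tau> \<in> \<Gamma>" "v \<in> accel_segs \<tau>"
  shows "0 < accel_wcet \<tau> v"
  using wcet_pos[OF assms(1,2)] assms(3) by (simp add: Process_in_phases)

lemma blocking_nonneg:
  assumes "task_system P \<Gamma>"
  shows "0 \<le> blocking \<Gamma> \<tau>"
proof (cases "\<exists>\<tau>'\<in>lp \<Gamma> \<tau>. \<exists>v. v \<in> accel_segs \<tau>'")
  case True
  then obtain \<tau>' v where \<tau>': "\<tau>' \<in> lp \<Gamma> \<tau>" "v \<in> accel_segs \<tau>'" by blast
  have "accel_wcet \<tau>' v \<le> blocking \<Gamma> \<tau>"
    using accel_wcet_le_blocking \<tau>' assms by (auto simp: task_system_def)
  moreover have "0 < accel_wcet \<tau>' v"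
    using accel_wcet_pos[OF assms] \<tau>' by (simp add: lp_def)
  ultimately show ?thesis by simp
next
  case False
  then show ?thesis by (auto simp: blocking_def)
qed

section \<open>Consequences of the scheduling rules in an arbitrary legal schedule\<close>

locale legal_schedule =
  fixes P :: "'p set" and \<Gamma> :: "'p task set" and \<sigma> :: "'p schedule"
  assumes task_system: "task_system P \<Gamma>" and legal: "legal \<Gamma> \<sigma>"
begin

lemma finite_tasks: "finite \<Gamma>"
  using task_system by (simp add: task_system_def)

lemma
  assumes "\<tau> \<in> \<Gamma>" "ph \<in> set (phases \<tau>)"
  shows actual_pos: "0 < actual \<sigma> \<tau> k ph"
    and actual_le_wcet: "actual \<sigma> \<tau> k ph \<le> wcet \<tau> ph"
    and runs_lebesgue: "runs \<sigma> \<tau> k ph \<in> sets lebesgue"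
  using legal assms by (auto simp: legal_def valid_durations_def)

lemma Process_run_cases:
  assumes "\<tau> \<in> \<Gamma>" "j \<in> accel_segs \<tau>"
  obtains "runs \<sigma> \<tau> k (Process j) = {}"
  | s where "runs \<sigma> \<tau> k (Process j) = {s..<s + actual \<sigma> \<tau> k (Process j)}"
      "pending \<sigma> \<tau> k (Process j) s"
      "\<And>\<tau>' k' j'. \<tau>' \<in> hp \<Gamma> \<tau> \<Longrightarrow> j' \<in> accel_segs \<tau>' \<Longrightarrow> \<not> pending \<sigma> \<tau>' k' (Process j') s"
  using legal assms unfolding legal_def nonpreemptive_fp_def by meson

lemma Process_runs_disjoint:
  assumes "\<tau> \<in> \<Gamma>" "j \<in> accel_segs \<tau>" "\<tau>' \<in> \<Gamma>" "j' \<in> accel_segs \<tau>'"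
    and "t \<in> runs \<sigma> \<tau> k (Process j)" "t \<in> runs \<sigma> \<tau>' k' (Process j')"
  shows "\<tau> = \<tau>' \<and> k = k' \<and> j = j'"
proof -
  have "\<forall>\<tau>\<in>\<Gamma>. \<forall>k. \<forall>j\<in>accel_segs \<tau>. \<forall>\<tau>'\<in>\<Gamma>. \<forall>k'. \<forall>j'\<in>accel_segs \<tau>'.
      (\<tau>, k, j) \<noteq> (\<tau>', k', j') \<longrightarrow> runs \<sigma> \<tau> k (Process j) \<inter> runs \<sigma> \<tau>' k' (Process j') = {}"
    using legal unfolding legal_def nonpreemptive_fp_def by (elim conjE)
  with assms(1-4) have "(\<tau>, k, j) \<noteq> (\<tau>', k', j') \<longrightarrow>
      runs \<sigma> \<tau> k (Process j) \<inter> runs \<sigma> \<tau>' k' (Process j') = {}"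
    by simp
  with assms(5,6) show ?thesis by auto
qed

lemma accel_work_conserving:
  assumes "\<tau> \<in> \<Gamma>" "j \<in> accel_segs \<tau>" "pending \<sigma> \<tau> k (Process j) t"
  obtains \<tau>' k' j' where "\<tau>' \<in> \<Gamma>" "j' \<in> accel_segs \<tau>'" "t \<in> runs \<sigma> \<tau>' k' (Process j')"
proof -
  have "\<forall>\<tau>\<in>\<Gamma>. \<forall>k. \<forall>j\<in>accel_segs \<tau>. \<forall>t. pending \<sigma> \<tau> k (Process j) t \<longrightarrow>
      (\<exists>\<tau>'\<in>\<Gamma>. \<exists>k'. \<exists>j'\<in>accel_segs \<tau>'. t \<in> runs \<sigma> \<tau>' k' (Process j'))"
    using legal unfolding legal_def nonpreemptive_fp_def by (elim conjE)
  with assms that show thesis by blast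
qed

lemma release_le_of_runs:
  assumes "\<tau> \<in> \<Gamma>" "ph \<in> set (phases \<tau>)" "t \<in> runs \<sigma> \<tau> k ph"
  shows "release \<sigma> \<tau> k \<le> t"
proof (cases "on_accel ph")
  case True
  then obtain j where ph: "ph = Process j" by (cases ph) auto
  then have "j \<in> accel_segs \<tau>" using assms(2) by (simp add: Process_in_phases)
  from assms(1) this show ?thesis
    by (rule Process_run_cases[of \<tau> j k]) (use assms ph in \<open>auto simp: pending_def ready_def\<close>)
next
  case False
  then have "ph \<in> core_phases \<tau>" using assms(2) by (simp add: core_phases_def)
  then have "pending \<sigma> \<tau> k ph t"
    using legal assms unfolding legal_def preemptive_fp_def by blast
  then show ?thesis by (simp add: pending_def ready_def)
qed

text \<open>Nothing runs before its release, so a run set cut off at \<open>t\<close> is bounded.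
  This finiteness is what makes \<open>completed\<close> monotone in time.\<close>

lemma runs_until:
  assumes "\<tau> \<in> \<Gamma>" "ph \<in> set (phases \<tau>)"
  shows "runs \<sigma> \<tau> k ph \<inter> {..t} \<in> fmeasurable lebesgue"
    and "measure lebesgue (runs \<sigma> \<tau> k ph \<inter> {..t}) \<le> max 0 (t - release \<sigma> \<tau> k)"
proof -
  have "runs \<sigma> \<tau> k ph \<inter> {..t} \<in> sets lebesgue"
    using runs_lebesgue[OF assms] by auto
  moreover have "runs \<sigma> \<tau> k ph \<inter> {..t} \<subseteq> {release \<sigma> \<tau> k..t}"
    using release_le_of_runs[OF assms] by auto
  ultimately show "runs \<sigma> \<tau> k ph \<inter> {..t} \<in> fmeasurable lebesgue"
    and "measure lebesgue (runs \<sigma> \<tau> k ph \<inter> {..t}) \<le> max 0 (t - release \<sigma> \<tau> k)"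
    by (rule measure_le_of_subset_Icc)+
qed

lemma completed_mono:
  assumes "\<tau> \<in> \<Gamma>" "ph \<in> set (phases \<tau>)" "completed \<sigma> \<tau> k ph t" "t \<le> t'"
  shows "completed \<sigma> \<tau> k ph t'"
proof -
  have "measure lebesgue (runs \<sigma> \<tau> k ph \<inter> {..t}) \<le> measure lebesgue (runs \<sigma> \<tau> k ph \<inter> {..t'})"
    using assms runs_until[OF assms(1,2)]
    by (intro measure_mono_fmeasurable) (auto dest: fmeasurableD)
  with assms(3) show ?thesis by (simp add: completed_def)
qed

lemma release_add_actual_le:
  assumes "\<tau> \<in> \<Gamma>" "ph \<in> set (phases \<tau>)" "completed \<sigma> \<tau> k ph t"
  shows "release \<sigma> \<tau> k + actual \<sigma> \<tau> k ph \<le> t"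
  using actual_pos[OF assms(1,2), of k] runs_until(2)[OF assms(1,2), of k t] assms(3)
  by (simp add: completed_def max_def split: if_splits)

lemma job_completed_mono:
  assumes "\<tau> \<in> \<Gamma>" "job_completed \<sigma> \<tau> k t" "t \<le> t'"
  shows "job_completed \<sigma> \<tau> k t'"
  using assms completed_mono unfolding job_completed_def by blast

lemma ready_mono:
  assumes "\<tau> \<in> \<Gamma>" "ready \<sigma> \<tau> k ph t" "t \<le> t'"
  shows "ready \<sigma> \<tau> k ph t'"
  using assms job_completed_mono completed_mono unfolding ready_def
  by (meson order_trans set_takeWhileD)

text \<open>The scheduling rule asserts pendingness at the start \<open>s\<close> only. At a later
  \<open>t\<close> of the right-open run, at most \<open>t - s\<close> of the work is done, which is
  less than the actual duration.\<close>

lemma pending_Process_of_runs: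
  assumes "\<tau> \<in> \<Gamma>" "j \<in> accel_segs \<tau>" "t \<in> runs \<sigma> \<tau> k (Process j)"
  shows "pending \<sigma> \<tau> k (Process j) t"
  using assms(1,2)
proof (cases rule: Process_run_cases[of \<tau> j k])
  case (2 s)
  then have s: "s \<le> t" "t < s + actual \<sigma> \<tau> k (Process j)" using assms(3) by auto
  have ready: "ready \<sigma> \<tau> k (Process j) t"
    using ready_mono[OF assms(1) _ s(1)] 2(2) by (simp add: pending_def)
  have "measure lebesgue (runs \<sigma> \<tau> k (Process j) \<inter> {..t}) \<le> max 0 (t - s)"
    by (rule measure_le_of_subset_Icc) (use 2 in auto)
  with s ready show ?thesis by (simp add: pending_def completed_def)
qed (use assms in auto)

text \<open>Readiness of the later of two jobs, or of two phases of one job, demands completion of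
  the earlier one, which then is not pending.\<close>

lemma pending_unique:
  assumes "\<tau> \<in> \<Gamma>" "ph \<in> set (phases \<tau>)" "ph' \<in> set (phases \<tau>)"
    and "pending \<sigma> \<tau> k ph t" "pending \<sigma> \<tau> k' ph' t"
  shows "k = k' \<and> ph = ph'"
proof -
  have "k = k'"
    using assms by (cases k k' rule: linorder_cases) (auto simp: pending_def ready_def job_completed_def)
  moreover have "ph = ph'"
    using assms takeWhile_neq_cases[of ph "phases \<tau>" ph'] \<open>k = k'\<close>
    by (auto simp: pending_def ready_def)
  ultimately show ?thesis by simp
qed

text \<open>Offloading cannot begin before the release, so its positive length separates the release
  from any use of the accelerator.\<close>

lemma Process_run_after_Offload:
  assumes "\<tau> \<in> \<Gamma>" "j \<in> accel_segs \<tau>" "t \<in> runs \<sigma> \<tau> k (Process j)"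
  shows "release \<sigma> \<tau> k + actual \<sigma> \<tau> k (Offload j) \<le> t"
proof -
  have "completed \<sigma> \<tau> k (Offload j) t"
    using pending_Process_of_runs[OF assms] takeWhile_Process[OF assms(2)]
    by (simp add: pending_def ready_def)
  then show ?thesis
    using release_add_actual_le[OF assms(1) Offload_in_phases[OF assms(2)]] by blast
qed

text \<open>Completion of a phase of positive duration means that it has run at some instant up to
  \<open>t\<close>. It was pending then, so the release and all its predecessors lie in the
  past.\<close>

lemma ready_Process:
  assumes "\<tau> \<in> \<Gamma>" "j \<in> accel_segs \<tau>" "completed \<sigma> \<tau> k (Offload j) t"
  shows "ready \<sigma> \<tau> k (Process j) t"
proof -
  have ph: "Offload j \<in> core_phases \<tau>" "Offload j \<in> set (phases \<tau>)"
    using Offload_in_phases[OF assms(2)] by (auto simp: core_phases_def)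
  have "0 < measure lebesgue (runs \<sigma> \<tau> k (Offload j) \<inter> {..t})"
    using assms(3) actual_pos[OF assms(1) ph(2), of k] by (simp add: completed_def)
  then have "runs \<sigma> \<tau> k (Offload j) \<inter> {..t} \<noteq> {}" by force
  then obtain t' where t': "t' \<in> runs \<sigma> \<tau> k (Offload j)" "t' \<le> t" by blast
  then have "pending \<sigma> \<tau> k (Offload j) t'"
    using legal assms(1) ph unfolding legal_def preemptive_fp_def by blast
  then have "ready \<sigma> \<tau> k (Offload j) t"
    using ready_mono[OF assms(1) _ t'(2)] by (simp add: pending_def)
  with assms(3) takeWhile_Process[OF assms(2)] show ?thesis
    by (simp add: ready_def)
qed

text \<open>The supremum \<open>wcrt\<close> covers the given schedule. The inequality with
  \<open>t\<close> is strict because the response time is an infimum, which is not known to be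
  attained.\<close>

lemma job_completed_after_deadline:
  assumes "\<tau> \<in> \<Gamma>" "wcrt \<Gamma> \<tau> \<le> ereal D" "release \<sigma> \<tau> k + D < t"
  shows "job_completed \<sigma> \<tau> k t"
proof -
  let ?I = "Inf {ereal t | t. job_completed \<sigma> \<tau> k t}"
  have "response_time \<sigma> \<tau> k \<le> wcrt \<Gamma> \<tau>"
    unfolding wcrt_def using legal by (intro Sup_upper) auto
  with assms(2) have "?I - ereal (release \<sigma> \<tau> k) \<le> ereal D"
    by (simp add: response_time_def)
  then have "?I \<le> ereal (release \<sigma> \<tau> k + D)"
    by (cases ?I) (auto simp: algebra_simps)
  also have "\<dots> < ereal t" using assms(3) by simp
  finally obtain t' where "job_completed \<sigma> \<tau> k t'" "t' < t"
    by (auto simp: Inf_less_iff)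
  then show ?thesis using job_completed_mono[OF assms(1)] by force
qed

lemma accel_runs_measure:
  assumes "\<tau> \<in> \<Gamma>" "j \<in> accel_segs \<tau>"
  shows "runs \<sigma> \<tau> k (Process j) \<in> fmeasurable lebesgue"
    and "measure lebesgue (runs \<sigma> \<tau> k (Process j)) \<le> accel_wcet \<tau> j"
proof -
  have ph: "Process j \<in> set (phases \<tau>)" using assms by (simp add: Process_in_phases)
  have "runs \<sigma> \<tau> k (Process j) \<in> fmeasurable lebesgue \<and>
    measure lebesgue (runs \<sigma> \<tau> k (Process j)) \<le> actual \<sigma> \<tau> k (Process j)"
    using assms
    by (rule Process_run_cases[of \<tau> j k])
      (use actual_pos[OF assms(1) ph, of k] Ico_lmeasurable in auto)
  with actual_le_wcet[OF assms(1) ph, of k]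
  show "runs \<sigma> \<tau> k (Process j) \<in> fmeasurable lebesgue"
    and "measure lebesgue (runs \<sigma> \<tau> k (Process j)) \<le> accel_wcet \<tau> j" by auto
qed

end

section \<open>A legal schedule with a long job\<close>

definition job_wcet :: "'p task \<Rightarrow> real" where
  "job_wcet \<tau> = sum_list (map (wcet \<tau>) (phases \<tau>))"

lemma accel_demand_le_job_wcet:
  assumes "task_system P \<Gamma>" "\<tau> \<in> \<Gamma>"
  shows "accel_demand \<tau> \<le> job_wcet \<tau>"
proof -
  have "accel_demand \<tau> = sum (wcet \<tau>) (Process ` accel_segs \<tau>)"
    by (simp add: accel_demand_def sum.reindex inj_on_def)
  also have "\<dots> \<le> sum (wcet \<tau>) (set (phases \<tau>))"
    using wcet_pos[OF assms] by (intro sum_mono2) (auto simp: Process_in_phases intro: less_imp_le)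
  also have "\<dots> = job_wcet \<tau>"
    by (simp add: job_wcet_def sum_list_distinct_conv_sum_set[OF distinct_phases])
  finally show ?thesis .
qed

text \<open>
  Job \<open>k\<close> of \<open>\<tau>\<close> occupies the interval from \<open>b \<tau> k\<close> of length \<open>len \<tau> k\<close>, and no other job runs in it,
  so that a phase is pending exactly while it runs.
\<close>

locale isolated_jobs =
  fixes P :: "'p set" and \<Gamma> :: "'p task set" and off :: "'p task \<Rightarrow> real"
    and b len :: "'p task \<Rightarrow> nat \<Rightarrow> real"
  assumes task_system: "task_system P \<Gamma>"
    and len_pos: "\<tau> \<in> \<Gamma> \<Longrightarrow> 0 < len \<tau> k"
    and len_le: "\<tau> \<in> \<Gamma> \<Longrightarrow> len \<tau> k \<le> job_wcet \<tau>"
    and release_le: "\<tau> \<in> \<Gamma> \<Longrightarrow> off \<tau> + real k * period \<tau> \<le> b \<tau> k"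
    and start_cases: "\<tau> \<in> \<Gamma> \<Longrightarrow>
      b \<tau> k = off \<tau> + real k * period \<tau> \<or> (\<exists>k'<k. b \<tau> k = b \<tau> k' + len \<tau> k')"
    and jobs_in_order: "\<tau> \<in> \<Gamma> \<Longrightarrow> k' < k \<Longrightarrow> b \<tau> k' + len \<tau> k' \<le> b \<tau> k"
    and jobs_isolated: "\<tau> \<in> \<Gamma> \<Longrightarrow> \<tau>' \<in> \<Gamma> \<Longrightarrow> (\<tau>, k) \<noteq> (\<tau>', k') \<Longrightarrow>
      b \<tau> k + len \<tau> k \<le> b \<tau>' k' \<or> b \<tau>' k' + len \<tau>' k' \<le> b \<tau> k"
begin

text \<open>All phases of a job shrink by one common factor, at most 1 by \<open>len_le\<close>, so
  that their durations add up to \<open>len\<close>.\<close>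

definition act :: "'p task \<Rightarrow> nat \<Rightarrow> phase \<Rightarrow> real" where
  "act \<tau> k ph = wcet \<tau> ph * (len \<tau> k / job_wcet \<tau>)"

definition start :: "'p task \<Rightarrow> nat \<Rightarrow> phase \<Rightarrow> real" where
  "start \<tau> k ph = b \<tau> k + sum_list (map (act \<tau> k) (takeWhile (\<lambda>q. q \<noteq> ph) (phases \<tau>)))"

definition sched :: "'p schedule" where
  "sched = \<lparr>offset = off, actual = act,
     runs = (\<lambda>\<tau> k ph. {start \<tau> k ph..<start \<tau> k ph + act \<tau> k ph})\<rparr>"

lemma sched_simps [simp]:
  "offset sched = off" "actual sched = act"
  "runs sched \<tau> k ph = {start \<tau> k ph..<start \<tau> k ph + act \<tau> k ph}"
  by (simp_all add: sched_def)

lemma act_bounds: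
  assumes "\<tau> \<in> \<Gamma>" "ph \<in> set (phases \<tau>)"
  shows "0 < act \<tau> k ph" "act \<tau> k ph \<le> wcet \<tau> ph"
proof -
  have W: "0 < wcet \<tau> ph" using wcet_pos[OF task_system assms] .
  have l: "0 < len \<tau> k / job_wcet \<tau>" "len \<tau> k / job_wcet \<tau> \<le> 1"
    using len_pos[OF assms(1), of k] len_le[OF assms(1), of k] by (auto simp: field_simps)
  show "0 < act \<tau> k ph" unfolding act_def by (rule mult_pos_pos[OF W l(1)])
  show "act \<tau> k ph \<le> wcet \<tau> ph" using W l unfolding act_def by (intro mult_left_le) auto
qed

lemma sum_act:
  assumes "\<tau> \<in> \<Gamma>"
  shows "sum_list (map (act \<tau> k) (phases \<tau>)) = len \<tau> k"
proof -
  have "sum_list (map (act \<tau> k) (phases \<tau>)) = job_wcet \<tau> * (len \<tau> k / job_wcet \<tau>)"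
    unfolding act_def[abs_def] sum_list_mult_const job_wcet_def ..
  then show ?thesis using len_pos[OF assms, of k] len_le[OF assms, of k] by simp
qed

lemma start_split:
  "phases \<tau> = xs @ ph # ys \<Longrightarrow> start \<tau> k ph = b \<tau> k + sum_list (map (act \<tau> k) xs)"
  using takeWhile_neq_distinct[of xs ph ys] distinct_phases[of \<tau>] by (simp add: start_def)

lemma sum_act_nonneg:
  "\<tau> \<in> \<Gamma> \<Longrightarrow> set xs \<subseteq> set (phases \<tau>) \<Longrightarrow> 0 \<le> sum_list (map (act \<tau> k) xs)"
  by (intro sum_list_nonneg) (auto intro!: less_imp_le[OF act_bounds(1)])

lemma start_bounds:
  assumes "\<tau> \<in> \<Gamma>" "ph \<in> set (phases \<tau>)"
  shows "b \<tau> k \<le> start \<tau> k ph" "start \<tau> k ph + act \<tau> k ph \<le> b \<tau> k + len \<tau> k"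
proof -
  obtain xs ys where eq: "phases \<tau> = xs @ ph # ys" using assms(2) by (meson split_list)
  have "0 \<le> sum_list (map (act \<tau> k) xs)" "0 \<le> sum_list (map (act \<tau> k) ys)"
    using assms(1) by (auto simp: eq intro!: sum_act_nonneg)
  then show "b \<tau> k \<le> start \<tau> k ph" "start \<tau> k ph + act \<tau> k ph \<le> b \<tau> k + len \<tau> k"
    using start_split[OF eq, of k] sum_act[OF assms(1), of k] by (auto simp: eq)
qed

lemma start_after:
  assumes "\<tau> \<in> \<Gamma>" "ph \<in> set (phases \<tau>)" "ph' \<in> set (takeWhile (\<lambda>q. q \<noteq> ph) (phases \<tau>))"
  shows "start \<tau> k ph' + act \<tau> k ph' \<le> start \<tau> k ph"
proof -
  obtain xs ys where eq: "phases \<tau> = xs @ ph # ys" using assms(2) by (meson split_list)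
  then have "takeWhile (\<lambda>q. q \<noteq> ph) (phases \<tau>) = xs"
    using takeWhile_neq_distinct[of xs ph ys] distinct_phases[of \<tau>] by simp
  with assms(3) obtain us vs where "xs = us @ ph' # vs" by (metis split_list)
  with eq have "phases \<tau> = us @ ph' # (vs @ ph # ys)" by simp
  moreover have "0 \<le> sum_list (map (act \<tau> k) vs)"
    using assms(1) by (intro sum_act_nonneg) (auto simp: eq \<open>xs = us @ ph' # vs\<close>)
  ultimately show ?thesis
    using start_split[OF eq, of k] start_split[of \<tau> us ph' "vs @ ph # ys" k]
    by (simp add: \<open>xs = us @ ph' # vs\<close>)
qed

section \<open>Completion, readiness and legality in the constructed schedule\<close>

lemma completed_iff:
  assumes "\<tau> \<in> \<Gamma>" "ph \<in> set (phases \<tau>)"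
  shows "completed sched \<tau> k ph t \<longleftrightarrow> start \<tau> k ph + act \<tau> k ph \<le> t"
proof -
  let ?s = "start \<tau> k ph" and ?a = "act \<tau> k ph"
  have a: "0 < ?a" using act_bounds[OF assms] by simp
  show ?thesis
  proof (cases "?s + ?a \<le> t")
    case True
    then have "{?s..<?s + ?a} \<inter> {..t} = {?s..<?s + ?a}" by auto
    with True a show ?thesis by (simp add: completed_def)
  next
    case False
    then have "measure lebesgue ({?s..<?s + ?a} \<inter> {..t}) \<le> max 0 (t - ?s)"
      by (intro measure_le_of_subset_Icc) auto
    with False a show ?thesis by (simp add: completed_def)
  qed
qed

lemma job_completed_iff:
  assumes "\<tau> \<in> \<Gamma>"
  shows "job_completed sched \<tau> k t \<longleftrightarrow> b \<tau> k + len \<tau> k \<le> t"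
proof
  let ?z = "last (phases \<tau>)"
  have eq: "phases \<tau> = butlast (phases \<tau>) @ ?z # []" using phases_nonempty[OF task_system assms] by simp
  assume "job_completed sched \<tau> k t"
  then have "start \<tau> k ?z + act \<tau> k ?z \<le> t"
    using phases_nonempty[OF task_system assms] completed_iff[OF assms] by (simp add: job_completed_def)
  moreover have "sum_list (map (act \<tau> k) (butlast (phases \<tau>))) + act \<tau> k ?z = len \<tau> k"
    unfolding sum_act[OF assms, symmetric] by (subst (3) eq) simp
  ultimately show "b \<tau> k + len \<tau> k \<le> t" using start_split[OF eq, of k] by simp
next
  assume "b \<tau> k + len \<tau> k \<le> t"
  then show "job_completed sched \<tau> k t"
    using start_bounds(2)[OF assms, of _ k] completed_iff[OF assms]
    by (force simp: job_completed_def)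
qed

text \<open>A phase other than the first starts when its immediate predecessor ends. For the first
  one, \<open>start_cases\<close> says that \<open>b\<close> is the release or the end of an earlier
  job, so readiness cannot come before \<open>b\<close>.\<close>

lemma ready_iff:
  assumes "\<tau> \<in> \<Gamma>" "ph \<in> set (phases \<tau>)"
  shows "ready sched \<tau> k ph t \<longleftrightarrow> start \<tau> k ph \<le> t"
proof -
  obtain xs ys where eq: "phases \<tau> = xs @ ph # ys" using assms(2) by (meson split_list)
  then have tw: "takeWhile (\<lambda>q. q \<noteq> ph) (phases \<tau>) = xs"
    using takeWhile_neq_distinct[of xs ph ys] distinct_phases[of \<tau>] by simp
  have xs: "completed sched \<tau> k q t \<longleftrightarrow> start \<tau> k q + act \<tau> k q \<le> t" if "q \<in> set xs" for q
    using completed_iff[OF assms(1)] eq that by simp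
  have R: "ready sched \<tau> k ph t \<longleftrightarrow> off \<tau> + real k * period \<tau> \<le> t \<and>
      (\<forall>k'<k. b \<tau> k' + len \<tau> k' \<le> t) \<and> (\<forall>q\<in>set xs. start \<tau> k q + act \<tau> k q \<le> t)"
    using xs job_completed_iff[OF assms(1)] by (simp add: ready_def tw release_def)
  show ?thesis
  proof
    assume ready: "ready sched \<tau> k ph t"
    show "start \<tau> k ph \<le> t"
    proof (cases xs rule: rev_cases)
      case Nil
      with start_split[OF eq, of k] have "start \<tau> k ph = b \<tau> k" by simp
      with ready start_cases[OF assms(1), of k] show ?thesis unfolding R by auto
    next
      case (snoc us z)
      then have "phases \<tau> = us @ z # (ph # ys)" using eq by simp
      from start_split[OF this, of k] start_split[OF eq, of k] snoc
      have "start \<tau> k ph = start \<tau> k z + act \<tau> k z" by simp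
      with ready snoc show ?thesis unfolding R by simp
    qed
  next
    assume "start \<tau> k ph \<le> t"
    moreover have "b \<tau> k \<le> start \<tau> k ph" using start_bounds[OF assms] by simp
    moreover have "start \<tau> k q + act \<tau> k q \<le> start \<tau> k ph" if "q \<in> set xs" for q
      using start_after[OF assms, of q k] tw that by simp
    ultimately show "ready sched \<tau> k ph t"
      unfolding R using release_le[OF assms(1), of k] jobs_in_order[OF assms(1), of _ k] by force
  qed
qed

lemma pending_iff:
  assumes "\<tau> \<in> \<Gamma>" "ph \<in> set (phases \<tau>)"
  shows "pending sched \<tau> k ph t \<longleftrightarrow> t \<in> runs sched \<tau> k ph"
  by (auto simp: pending_def ready_iff[OF assms] completed_iff[OF assms])

lemma runs_unique:
  assumes "\<tau> \<in> \<Gamma>" "ph \<in> set (phases \<tau>)" "\<tau>' \<in> \<Gamma>" "ph' \<in> set (phases \<tau>')"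
    and t: "t \<in> runs sched \<tau> k ph" "t \<in> runs sched \<tau>' k' ph'"
  shows "\<tau> = \<tau>' \<and> k = k' \<and> ph = ph'"
proof -
  have "t \<in> {b \<tau> k..<b \<tau> k + len \<tau> k}" "t \<in> {b \<tau>' k'..<b \<tau>' k' + len \<tau>' k'}"
    using t start_bounds[OF assms(1,2), of k] start_bounds[OF assms(3,4), of k'] by auto
  then have eq: "\<tau> = \<tau>'" "k = k'"
    using jobs_isolated[OF assms(1,3), of k k'] by auto
  moreover have "ph = ph'"
    using takeWhile_neq_cases[of ph "phases \<tau>" ph'] assms eq
      start_after[of \<tau> ph ph' k] start_after[of \<tau> ph' ph k] by force
  ultimately show ?thesis by simp
qed

text \<open>Whatever is pending runs, and no two phases run at once. So no phase of higher priority
  is pending while a phase runs, and each pending processing phase is itself the witness of work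
  conservation.\<close>

lemma legal_sched: "legal \<Gamma> sched"
proof -
  have pend: "pending sched \<tau> k (Process j) t \<longleftrightarrow> t \<in> runs sched \<tau> k (Process j)"
    if "\<tau> \<in> \<Gamma>" "j \<in> accel_segs \<tau>" for \<tau> j k t
    using pending_iff[OF that(1)] that(2) by (simp add: Process_in_phases)
  have hp_idle: "\<not> pending sched \<tau>' k' ph' t"
    if "\<tau> \<in> \<Gamma>" "ph \<in> set (phases \<tau>)" "t \<in> runs sched \<tau> k ph"
      "\<tau>' \<in> hp \<Gamma> \<tau>" "ph' \<in> set (phases \<tau>')" for \<tau> k ph \<tau>' k' ph' t
  proof
    have "\<tau>' \<in> \<Gamma>" using that(4) by (simp add: hp_def)
    moreover assume "pending sched \<tau>' k' ph' t"
    ultimately have "\<tau> = \<tau>'"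
      using runs_unique[OF that(1,2) _ that(5,3)] pending_iff[OF _ that(5)] by blast
    with that(4) show False by (simp add: hp_def)
  qed
  have "valid_durations \<Gamma> sched"
    unfolding valid_durations_def using act_bounds by auto
  moreover have "preemptive_fp \<Gamma> sched"
    unfolding preemptive_fp_def
  proof (intro ballI allI)
    fix \<tau> k ph t assume \<tau>: "\<tau> \<in> \<Gamma>" "ph \<in> core_phases \<tau>"
    then have "ph \<in> set (phases \<tau>)" by (simp add: core_phases_def)
    with \<tau>(1) show "t \<in> runs sched \<tau> k ph \<longleftrightarrow> pending sched \<tau> k ph t \<and>
          (\<forall>\<tau>'\<in>hp \<Gamma> \<tau>. core \<tau>' = core \<tau> \<longrightarrow>
             (\<forall>k'. \<forall>ph'\<in>core_phases \<tau>'. \<not> pending sched \<tau>' k' ph' t))"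
      using pending_iff hp_idle unfolding core_phases_def by blast
  qed
  moreover have "nonpreemptive_fp \<Gamma> sched"
    unfolding nonpreemptive_fp_def
  proof (intro conjI ballI allI impI)
    fix \<tau> k j assume \<tau>: "\<tau> \<in> \<Gamma>" "j \<in> accel_segs \<tau>"
    let ?s = "start \<tau> k (Process j)"
    have ph: "Process j \<in> set (phases \<tau>)" using \<tau>(2) by (simp add: Process_in_phases)
    have s: "?s \<in> runs sched \<tau> k (Process j)" using act_bounds[OF \<tau>(1) ph] by simp
    show "runs sched \<tau> k (Process j) = {} \<or>
        (\<exists>s. runs sched \<tau> k (Process j) = {s..<s + actual sched \<tau> k (Process j)} \<and>
             pending sched \<tau> k (Process j) s \<and>
             (\<forall>\<tau>'\<in>hp \<Gamma> \<tau>. \<forall>k'. \<forall>j'\<in>accel_segs \<tau>'. \<not> pending sched \<tau>' k' (Process j') s))"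
      using hp_idle[OF \<tau>(1) ph s] pend[OF \<tau>] s
      by (intro disjI2 exI[of _ ?s]) (simp add: Process_in_phases)
  next
    fix \<tau> \<tau>' and k k' :: nat and j j'
    assume "\<tau> \<in> \<Gamma>" "j \<in> accel_segs \<tau>" "\<tau>' \<in> \<Gamma>" "j' \<in> accel_segs \<tau>'" "(\<tau>, k, j) \<noteq> (\<tau>', k', j')"
    then show "runs sched \<tau> k (Process j) \<inter> runs sched \<tau>' k' (Process j') = {}"
      using runs_unique[of \<tau> "Process j" \<tau>' "Process j'" _ k k'] unfolding Process_in_phases by blast
  next
    fix \<tau> k j t
    assume \<tau>: "\<tau> \<in> \<Gamma>" "j \<in> accel_segs \<tau>" and "pending sched \<tau> k (Process j) t"
    then have "t \<in> runs sched \<tau> k (Process j)" using pend[OF \<tau>] by blast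
    with \<tau> show "\<exists>\<tau>'\<in>\<Gamma>. \<exists>k'. \<exists>j'\<in>accel_segs \<tau>'. t \<in> runs sched \<tau>' k' (Process j')" by blast
  qed
  ultimately show ?thesis by (simp add: legal_def)
qed

text \<open>Since \<open>wcrt\<close> is a supremum over legal schedules, each job of this one
  schedule bounds it from below.\<close>

lemma wcrt_ge:
  assumes "\<tau> \<in> \<Gamma>"
  shows "ereal (b \<tau> k + len \<tau> k - (off \<tau> + real k * period \<tau>)) \<le> wcrt \<Gamma> \<tau>"
proof -
  let ?I = "Inf {ereal t | t. job_completed sched \<tau> k t}"
  have "ereal (b \<tau> k + len \<tau> k) \<le> ?I"
    using job_completed_iff[OF assms] by (intro Inf_greatest) auto
  then have "ereal (b \<tau> k + len \<tau> k) - ereal (release sched \<tau> k) \<le> response_time sched \<tau> k"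
    unfolding response_time_def by (rule ereal_minus_mono) simp
  also have "\<dots> \<le> wcrt \<Gamma> \<tau>"
    unfolding wcrt_def using legal_sched by (intro Sup_upper) auto
  finally show ?thesis by (simp add: release_def)
qed

end

text \<open>Offsets are chosen one element at a time. Only countably many values let a release of
  the new element coincide with one of an earlier element, and an open interval above
  \<open>M\<close> is uncountable.\<close>

lemma generic_offsets:
  fixes T :: "'b \<Rightarrow> real" and M :: real
  assumes "finite A" "h \<notin> A"
  obtains off where "off h = 0" "\<And>x. x \<in> A \<Longrightarrow> M < off x"
    "\<And>x y k l. x \<in> insert h A \<Longrightarrow> y \<in> insert h A \<Longrightarrow> x \<noteq> y \<Longrightarrow>
       off x + real k * T x \<noteq> off y + real l * T y"
proof -
  have "\<exists>off. off h = 0 \<and> (\<forall>x\<in>A. M < off x) \<and> (\<forall>x\<in>insert h A. \<forall>y\<in>insert h A. x \<noteq> y \<longrightarrow>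
       (\<forall>k l. off x + real k * T x \<noteq> off y + real l * T y))"
    using assms
  proof (induction A)
    case empty
    show ?case by (intro exI[of _ "\<lambda>_. 0"]) auto
  next
    case (insert z A)
    then obtain off where off: "off h = 0" "\<forall>x\<in>A. M < off x"
      "\<forall>x\<in>insert h A. \<forall>y\<in>insert h A. x \<noteq> y \<longrightarrow>
         (\<forall>k l. off x + real k * T x \<noteq> off y + real l * T y)" by auto
    let ?bad = "\<Union>y\<in>insert h A. range (\<lambda>(k, l). off y + real l * T y - real k * T z)"
    have "countable ?bad" using insert.hyps by (intro countable_UN) (auto simp: countable_finite)
    moreover have "uncountable {M<..<M + 1}" by (simp add: uncountable_open_interval)
    ultimately have "\<not> {M<..<M + 1} \<subseteq> ?bad" using countable_subset by blast
    then obtain v where v: "v \<in> {M<..<M + 1}" "v \<notin> ?bad" by blast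
    have v_ne: "v + real k * T z \<noteq> off y + real l * T y" if "y \<in> insert h A" for y k l
    proof
      assume "v + real k * T z = off y + real l * T y"
      then have "v = (\<lambda>(k, l). off y + real l * T y - real k * T z) (k, l)" by simp
      with that v(2) show False by blast
    qed
    have "z \<noteq> h" using insert.prems by auto
    show ?case
    proof (intro exI[of _ "off(z := v)"] conjI ballI impI allI)
      fix x y and k l :: nat assume "x \<in> insert h (insert z A)" "y \<in> insert h (insert z A)" "x \<noteq> y"
      then show "(off(z := v)) x + real k * T x \<noteq> (off(z := v)) y + real l * T y"
        using off(3) v_ne[of y k l] v_ne[of x l k] by (cases "x = z"; cases "y = z") auto
    qed (use off v \<open>z \<noteq> h\<close> in auto)
  qed
  with that show thesis by metis
qed

text \<open>
  If the demand exceeded the deadline, a job that alone takes longer than the deadline would fit in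
  a legal schedule: all other jobs run later or are so short that they never interfere.
\<close>

lemma accel_demand_le_deadline:
  assumes sys: "task_system P \<Gamma>" and h: "h \<in> \<Gamma>" and wcrt: "wcrt \<Gamma> h \<le> ereal (deadline h)"
  shows "accel_demand h \<le> deadline h"
proof (rule ccontr)
  assume "\<not> accel_demand h \<le> deadline h"
  let ?T = "period h" and ?D = "deadline h"
  have D: "0 < ?D" "?D \<le> ?T" using sys h by (auto simp: task_system_def)
  have T: "0 < period \<tau>" if "\<tau> \<in> \<Gamma>" for \<tau> using sys that by (force simp: task_system_def)
  have W: "0 < job_wcet \<tau>" if "\<tau> \<in> \<Gamma>" for \<tau>
  proof -
    have "0 < sum (wcet \<tau>) (set (phases \<tau>))"
      using wcet_pos[OF sys that] phases_nonempty[OF sys that] by (intro sum_pos) auto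
    then show ?thesis by (simp add: job_wcet_def sum_list_distinct_conv_sum_set[OF distinct_phases])
  qed
  \<comment> \<open>Length of the long job 0 of \<open>h\<close>. It exceeds the deadline since both
    arguments of the minimum do, and the cap at one and a half periods lets the job end before the
    release of job 2.\<close>
  define c where "c = min (job_wcet h) (3 / 2 * ?T)"
  have c: "?D < c" "c < 2 * ?T" "c \<le> job_wcet h"
    using D accel_demand_le_job_wcet[OF sys h] \<open>\<not> _\<close> by (auto simp: c_def)
  have fin: "finite \<Gamma>" using sys by (simp add: task_system_def)
  \<comment> \<open>The other tasks are released only after \<open>2 * ?T\<close>, clear of the long
    job and of the start of job 1 of \<open>h\<close>.\<close>
  obtain off where off: "off h = 0" "\<And>\<tau>. \<tau> \<in> \<Gamma> - {h} \<Longrightarrow> 2 * ?T < off \<tau>"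
    and off_ne: "\<And>\<tau> \<tau>' k l. \<tau> \<in> \<Gamma> \<Longrightarrow> \<tau>' \<in> \<Gamma> \<Longrightarrow> \<tau> \<noteq> \<tau>' \<Longrightarrow>
       off \<tau> + real k * period \<tau> \<noteq> off \<tau>' + real l * period \<tau>'"
    using generic_offsets[of "\<Gamma> - {h}" h "2 * ?T" period] fin h by (auto simp: insert_absorb)
  \<comment> \<open>Every job starts at its release, except that job 1 of \<open>h\<close> may have
    to wait for the end of job 0.\<close>
  define b where "b \<tau> k = (if \<tau> = h \<and> k = 1 then max ?T c else off \<tau> + real k * period \<tau>)" for \<tau> k
  have b_ge: "off \<tau> + real k * period \<tau> \<le> b \<tau> k" for \<tau> k by (auto simp: b_def off)
  have b_later: "2 * ?T \<le> b \<tau> k" if "\<tau> \<in> \<Gamma>" "\<tau> \<noteq> h \<or> 2 \<le> k" for \<tau> k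
  proof (cases "\<tau> = h")
    case True
    then have "2 * ?T \<le> real k * ?T" using that T[OF h] by (intro mult_right_mono) auto
    then show ?thesis using True b_ge[of \<tau> k] off by simp
  next
    case False
    then have "2 * ?T < off \<tau>" using off(2) that by simp
    moreover have "0 \<le> real k * period \<tau>" using T[OF that(1)] by simp
    ultimately show ?thesis using b_ge[of \<tau> k] by linarith
  qed
  have b01: "b h 0 = 0" "?T \<le> b h 1" "c \<le> b h 1" "b h 1 < 2 * ?T"
    using c D by (auto simp: b_def off)
  have b_strict: "b \<tau> k < b \<tau> l" if "\<tau> \<in> \<Gamma>" "k < l" for \<tau> k l
  proof (cases "\<tau> = h \<and> k \<le> 1")
    case True
    have "k = 0 \<and> l = 1 \<or> 2 \<le> l" using that(2) by linarith
    with True consider "k = 0" "l = 1" | "k \<le> 1" "2 \<le> l" by blast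
    then show ?thesis
    proof cases
      case 1
      then show ?thesis using True b01 T[OF h] by simp
    next
      case 2
      then have "k = 0 \<or> k = 1" by auto
      with b_later[of h l] 2 True b01 T[OF h] h show ?thesis by auto
    qed
  next
    case False
    then show ?thesis using that T[OF that(1)] by (auto simp: b_def)
  qed
  have b_ne: "b \<tau> k \<noteq> b \<tau>' k'" if "\<tau> \<in> \<Gamma>" "\<tau>' \<in> \<Gamma>" "(\<tau>, k) \<noteq> (\<tau>', k')" for \<tau> k \<tau>' k'
  proof (cases "\<tau> = \<tau>'")
    case True
    with that b_strict[OF that(1), of k k'] b_strict[OF that(1), of k' k] show ?thesis
      by (cases k k' rule: linorder_cases) auto
  next
    case False
    consider "\<tau> = h" "k = 1" | "\<tau>' = h" "k' = 1" | "\<not> (\<tau> = h \<and> k = 1)" "\<not> (\<tau>' = h \<and> k' = 1)"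
      by blast
    then show ?thesis
    proof cases
      case 1
      then show ?thesis using b_later[of \<tau>' k'] b01 that False by auto
    next
      case 2
      then show ?thesis using b_later[of \<tau> k] b01 that False by auto
    next
      case 3
      then show ?thesis using off_ne[OF that(1,2) False] by (auto simp: b_def)
    qed
  qed
  \<comment> \<open>A length that ends the job no later than any later start. For the long job the
    length is prescribed, and \<open>c\<close> itself has this property.\<close>
  have "\<exists>l. 0 < l \<and> l \<le> job_wcet \<tau> \<and> (\<tau> = h \<and> k = 0 \<longrightarrow> l = c) \<and>
      (\<forall>\<tau>'\<in>\<Gamma>. \<forall>k'. b \<tau> k < b \<tau>' k' \<longrightarrow> b \<tau> k + l \<le> b \<tau>' k')" if \<tau>: "\<tau> \<in> \<Gamma>" for \<tau> k
  proof (cases "\<tau> = h \<and> k = 0")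
    case True
    have "c \<le> b \<tau>' k'" if "\<tau>' \<in> \<Gamma>" "0 < b \<tau>' k'" for \<tau>' k'
    proof (cases "\<tau>' = h \<and> k' < 2")
      case True
      then have "k' = 0 \<or> k' = 1" by auto
      with True that b01 show ?thesis by auto
    next
      case False
      with b_later[OF that(1), of k'] c show ?thesis by auto
    qed
    with True c D b01 show ?thesis by (intro exI[of _ c]) auto
  next
    case False
    \<comment> \<open>Starts within the next time unit: finitely many, as no start precedes its
      release. Later starts are harmless because the length is at most 1.\<close>
    let ?X = "Sigma \<Gamma> (\<lambda>\<tau>'. {k'. b \<tau> k < b \<tau>' k' \<and> b \<tau>' k' < b \<tau> k + 1})"
    have "finite {k'. b \<tau> k < b \<tau>' k' \<and> b \<tau>' k' < b \<tau> k + 1}" if "\<tau>' \<in> \<Gamma>" for \<tau>'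
      using b_ge[of \<tau>'] by (intro finite_subset[OF _ finite_arith_progression_less[OF T[OF that],
            of "off \<tau>'" "b \<tau> k + 1"]]) (auto intro: le_less_trans)
    then have "finite ?X" using fin by blast
    then obtain l where l: "0 < l" "l \<le> min 1 (job_wcet \<tau>)"
      and lX: "\<And>x. x \<in> ?X \<Longrightarrow> l \<le> (case x of (\<tau>', k') \<Rightarrow> b \<tau>' k' - b \<tau> k)"
      by (rule obtain_pos_lower_bound[of ?X "\<lambda>(\<tau>', k'). b \<tau>' k' - b \<tau> k" "min 1 (job_wcet \<tau>)"])
        (use W[OF \<tau>] in auto)
    have "b \<tau> k + l \<le> b \<tau>' k'" if "\<tau>' \<in> \<Gamma>" "b \<tau> k < b \<tau>' k'" for \<tau>' k'
      using lX[of "(\<tau>', k')"] that l(2) by (cases "b \<tau>' k' < b \<tau> k + 1") auto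
    with l False show ?thesis by (intro exI[of _ l]) auto
  qed
  then obtain len where len: "\<And>\<tau> k. \<tau> \<in> \<Gamma> \<Longrightarrow> 0 < len \<tau> k \<and> len \<tau> k \<le> job_wcet \<tau> \<and>
      (\<tau> = h \<and> k = 0 \<longrightarrow> len \<tau> k = c) \<and>
      (\<forall>\<tau>'\<in>\<Gamma>. \<forall>k'. b \<tau> k < b \<tau>' k' \<longrightarrow> b \<tau> k + len \<tau> k \<le> b \<tau>' k')"
    by metis
  interpret isolated_jobs P \<Gamma> off b len
  proof
    fix \<tau> k assume \<tau>: "\<tau> \<in> \<Gamma>"
    \<comment> \<open>The sole delayed start is that of job 1 of \<open>h\<close> when
      \<open>c\<close> exceeds the period; it then equals the end of job 0.\<close>
    show "b \<tau> k = off \<tau> + real k * period \<tau> \<or> (\<exists>k'<k. b \<tau> k = b \<tau> k' + len \<tau> k')"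
    proof (cases "\<tau> = h \<and> k = 1 \<and> ?T < c")
      case True
      then have "b \<tau> k = b \<tau> 0 + len \<tau> 0" using len[OF h, of 0] b01 by (simp add: b_def off)
      with True show ?thesis by auto
    next
      case False
      then show ?thesis by (auto simp: b_def off)
    qed
  next
    fix \<tau> \<tau>' and k k' :: nat assume "\<tau> \<in> \<Gamma>" "\<tau>' \<in> \<Gamma>" "(\<tau>, k) \<noteq> (\<tau>', k')"
    \<comment> \<open>Start instants are pairwise distinct, so one of the two jobs starts first and
      ends by the start of the other.\<close>
    then show "b \<tau> k + len \<tau> k \<le> b \<tau>' k' \<or> b \<tau>' k' + len \<tau>' k' \<le> b \<tau> k"
      using b_ne[of \<tau> \<tau>' k k'] len by (metis less_linear)
  qed (use sys len b_ge b_strict in auto)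
  \<comment> \<open>Job 0 of \<open>h\<close>, released and started at 0, has response time at least
    \<open>c\<close>.\<close>
  have "ereal c \<le> wcrt \<Gamma> h"
    using wcrt_ge[OF h, of 0] len[OF h, of 0] b01 off by simp
  then have "ereal c \<le> ereal ?D" using wcrt by (rule order_trans)
  with c show False by simp
qed

section \<open>Waiting time on the accelerator\<close>

context legal_schedule
begin

lemma period_deadline:
  assumes "\<tau> \<in> \<Gamma>"
  shows "0 < deadline \<tau>" "deadline \<tau> \<le> period \<tau>" "0 < period \<tau>"
  using task_system assms by (force simp: task_system_def)+

lemma accel_demand_nonneg: "\<tau> \<in> \<Gamma> \<Longrightarrow> 0 \<le> accel_demand \<tau>"
  using accel_wcet_pos[OF task_system] by (force simp: accel_demand_def intro: sum_nonneg)

definition accel_busy :: "'p task \<Rightarrow> nat \<Rightarrow> real set \<Rightarrow> real set" where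
  "accel_busy \<tau> n W = (\<Union>v\<in>accel_segs \<tau>. runs \<sigma> \<tau> n (Process v)) \<inter> W"

lemma accel_busy_lmeasurable:
  assumes "\<tau> \<in> \<Gamma>"
  shows "accel_busy \<tau> n {a..<b} \<in> fmeasurable lebesgue"
  unfolding accel_busy_def using accel_runs_measure[OF assms] Ico_lmeasurable
  by (intro fmeasurable_Int_fmeasurable fmeasurable.finite_UN) (auto dest: fmeasurableD)

text \<open>
  The window exceeds \<open>r + L\<close> by at most the length of every offloading phase, so a job released at
  \<open>r + L\<close> or later cannot reach the accelerator within it.
\<close>

lemma hp_workload_le:
  assumes h: "h \<in> \<Gamma>" "wcrt \<Gamma> h \<le> ereal (deadline h)" "accel_demand h \<le> deadline h"
    and "0 < L" "0 < d"
    and J: "J = {n. release \<sigma> h n < r + L + d}"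
    and d: "\<And>n v. n \<in> J \<Longrightarrow> v \<in> accel_segs h \<Longrightarrow> d \<le> actual \<sigma> h n (Offload v)"
  shows "(\<Sum>n\<in>J. measure lebesgue (accel_busy h n {r..<r + L + d}))
    \<le> real_of_int \<lceil>(L + deadline h - accel_demand h) / period h\<rceil> * accel_demand h"
proof (rule sum_periodic_contributions_le[where a = "offset \<sigma> h" and r = r])
  note T = period_deadline[OF h(1)]
  show "finite J" unfolding J release_def by (rule finite_arith_progression_less[OF T(3)])
  let ?W = "{r..<r + L + d}"
  have sets: "accel_busy h n ?W \<in> sets lebesgue" for n
    using accel_busy_lmeasurable[OF h(1)] by (rule fmeasurableD)
  show "measure lebesgue (accel_busy h n ?W) \<le> accel_demand h" for n
  proof -
    let ?U = "\<Union>v\<in>accel_segs h. runs \<sigma> h n (Process v)"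
    have "measure lebesgue (accel_busy h n ?W) \<le> measure lebesgue ?U"
      using accel_runs_measure[OF h(1)] sets
      by (intro measure_mono_fmeasurable fmeasurable.finite_UN) (auto simp: accel_busy_def)
    also have "\<dots> \<le> (\<Sum>v\<in>accel_segs h. measure lebesgue (runs \<sigma> h n (Process v)))"
      using accel_runs_measure[OF h(1)] by (intro measure_UNION_le) (auto dest: fmeasurableD)
    also have "\<dots> \<le> accel_demand h"
      unfolding accel_demand_def using accel_runs_measure[OF h(1)] by (intro sum_mono) auto
    finally show ?thesis .
  qed
  show "measure lebesgue (accel_busy h n ?W) \<le> max 0 (offset \<sigma> h + real n * period h + deadline h - r)" for n
  proof (rule measure_le_of_subset_Icc(2)[OF sets])
    \<comment> \<open>Strictly after its deadline the job is complete, so none of its processing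
      phases can still run.\<close>
    show "accel_busy h n ?W \<subseteq> {r..offset \<sigma> h + real n * period h + deadline h}"
    proof
      fix t assume t: "t \<in> accel_busy h n ?W"
      then obtain v where v: "v \<in> accel_segs h" "t \<in> runs \<sigma> h n (Process v)" and "r \<le> t"
        by (auto simp: accel_busy_def)
      have "\<not> job_completed \<sigma> h n t"
        using pending_Process_of_runs[OF h(1) v] v(1)
        by (auto simp: pending_def job_completed_def Process_in_phases)
      then have "t \<le> release \<sigma> h n + deadline h"
        using job_completed_after_deadline[OF h(1,2)] by (meson not_less)
      with \<open>r \<le> t\<close> show "t \<in> {r..offset \<sigma> h + real n * period h + deadline h}"
        by (simp add: release_def)
    qed
  qed
  show "measure lebesgue (accel_busy h n ?W) \<le> max 0 (r + L - (offset \<sigma> h + real n * period h))"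
    if "n \<in> J" for n
  proof -
    \<comment> \<open>Offloading postpones the accelerator use by at least \<open>d\<close>, which
      cancels the excess \<open>d\<close> at the end of the window.\<close>
    have "accel_busy h n ?W \<subseteq> {release \<sigma> h n + d..r + L + d}"
    proof
      fix t assume "t \<in> accel_busy h n ?W"
      then obtain v where v: "v \<in> accel_segs h" "t \<in> runs \<sigma> h n (Process v)" and "t < r + L + d"
        by (auto simp: accel_busy_def)
      then show "t \<in> {release \<sigma> h n + d..r + L + d}"
        using Process_run_after_Offload[OF h(1) v] d[OF that v(1)] by simp
    qed
    from measure_le_of_subset_Icc(2)[OF sets this] show ?thesis
      by (simp add: release_def algebra_simps)
  qed
qed (use assms period_deadline accel_demand_nonneg in auto)

text \<open>Here \<open>r\<close> is any instant by which offloading is complete, since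
  \<open>finish_time\<close> is an infimum and is approached through such instants.\<close>

lemma Process_starts_within:
  assumes \<tau>: "\<tau> \<in> \<Gamma>" "j \<in> accel_segs \<tau>" and r: "completed \<sigma> \<tau> k (Offload j) r"
    and hp: "\<And>h. h \<in> hp \<Gamma> \<tau> \<Longrightarrow> wcrt \<Gamma> h \<le> ereal (deadline h)"
      "\<And>h. h \<in> hp \<Gamma> \<tau> \<Longrightarrow> accel_demand h \<le> deadline h"
    and \<Phi>: "0 < \<Phi>" "\<Phi> = blocking \<Gamma> \<tau> + (\<Sum>h\<in>hp \<Gamma> \<tau>.
      real_of_int \<lceil>(\<Phi> + deadline h - accel_demand h) / period h\<rceil> * accel_demand h)"
  obtains s where "s \<le> r + \<Phi>"
    "runs \<sigma> \<tau> k (Process j) = {s..<s + actual \<sigma> \<tau> k (Process j)}"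
proof (rule ccontr)
  assume "\<not> thesis"
  \<comment> \<open>The negated goal leaves two cases: the phase never runs, or its run starts after
    \<open>r + \<Phi>\<close>.\<close>
  have late: "r + \<Phi> < t" if t: "t \<in> runs \<sigma> \<tau> k (Process j)" for t
    using \<tau>
  proof (cases rule: Process_run_cases[of \<tau> j k])
    case (2 s)
    then have "r + \<Phi> < s" using that \<open>\<not> thesis\<close> \<open>\<And>s. _ \<Longrightarrow> _ \<Longrightarrow> thesis\<close> by (meson not_less)
    with t 2 show ?thesis by auto
  qed (use t in auto)
  have pend: "pending \<sigma> \<tau> k (Process j) t"
    if "r \<le> t" "\<And>t'. t' \<le> t \<Longrightarrow> t' \<notin> runs \<sigma> \<tau> k (Process j)" for t
  proof -
    have "ready \<sigma> \<tau> k (Process j) t"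
      using ready_mono[OF \<tau>(1) ready_Process[OF \<tau> r] that(1)] .
    moreover have "runs \<sigma> \<tau> k (Process j) \<inter> {..t} = {}" using that(2) by auto
    ultimately show ?thesis
      using actual_pos[OF \<tau>(1), of "Process j" k] \<tau>(2)
      by (simp add: pending_def completed_def Process_in_phases)
  qed
  have "pending \<sigma> \<tau> k (Process j) (r + \<Phi>)"
    using late \<Phi>(1) by (intro pend) force+
  then obtain \<tau>1 k1 j1 where run1: "\<tau>1 \<in> \<Gamma>" "j1 \<in> accel_segs \<tau>1"
      "r + \<Phi> \<in> runs \<sigma> \<tau>1 k1 (Process j1)"
    by (rule accel_work_conserving[OF \<tau>])
  \<comment> \<open>Some phase occupies the accelerator at \<open>r + \<Phi>\<close> itself. As its
    run is right-open, it continues beyond, which leaves room to lengthen the window.\<close>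
  obtain e1 where e1: "r + \<Phi> < e1" "{r + \<Phi>..<e1} \<subseteq> runs \<sigma> \<tau>1 k1 (Process j1)"
    using run1(1,2)
  proof (cases rule: Process_run_cases[of \<tau>1 j1 k1])
    case (2 s)
    with run1(3) show thesis by (intro that[of "s + actual \<sigma> \<tau>1 k1 (Process j1)"]) auto
  qed (use run1 in auto)
  \<comment> \<open>The jobs of the window depend on \<open>d\<close>, while \<open>d\<close> must
    lie below their offloading lengths. Capping \<open>d\<close> by 1 and using all jobs released
    before \<open>r + \<Phi> + 1\<close> avoids the circularity.\<close>
  define J0 where "J0 h = {n. release \<sigma> h n < r + \<Phi> + 1}" for h
  let ?X = "Sigma (hp \<Gamma> \<tau>) (\<lambda>h. J0 h \<times> accel_segs h)"
  have hp_tasks: "finite (hp \<Gamma> \<tau>)" "hp \<Gamma> \<tau> \<subseteq> \<Gamma>"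
    using finite_tasks by (auto simp: hp_def)
  have finJ0: "finite (J0 h)" if "h \<in> hp \<Gamma> \<tau>" for h
    unfolding J0_def release_def
    using that hp_tasks period_deadline by (intro finite_arith_progression_less) auto
  have "finite ?X" using hp_tasks finJ0 by auto
  then obtain d where d: "0 < d" "d \<le> min 1 (e1 - (r + \<Phi>))"
    and dX: "\<And>x. x \<in> ?X \<Longrightarrow> d \<le> (case x of (h, n, v) \<Rightarrow> actual \<sigma> h n (Offload v))"
  proof (rule obtain_pos_lower_bound[of ?X "\<lambda>(h, n, v). actual \<sigma> h n (Offload v)" "min 1 (e1 - (r + \<Phi>))"])
    show "0 < (case x of (h, n, v) \<Rightarrow> actual \<sigma> h n (Offload v))" if "x \<in> ?X" for x
      using that hp_tasks(2) by (auto intro!: actual_pos Offload_in_phases)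
  qed (use e1 in auto)
  let ?W = "{r..<r + \<Phi> + d}"
  \<comment> \<open>In the added stretch the accelerator belongs to the phase found at
    \<open>r + \<Phi>\<close>. By mutual exclusion a run of the analysed phase there would make the
    two equal, contradicting \<open>late\<close>.\<close>
  have not_run: "t \<notin> runs \<sigma> \<tau> k (Process j)" if "t < r + \<Phi> + d" for t
  proof
    assume t: "t \<in> runs \<sigma> \<tau> k (Process j)"
    with late have "r + \<Phi> < t" by blast
    with that d(2) e1(2) have "t \<in> runs \<sigma> \<tau>1 k1 (Process j1)" by auto
    from Process_runs_disjoint[OF \<tau> run1(1,2) t this] late run1(3) show False by blast
  qed
  have pendW: "pending \<sigma> \<tau> k (Process j) t" if "t \<in> ?W" for t
    using that not_run by (intro pend) auto
  \<comment> \<open>A phase of lower priority cannot start while the analysed one is pending. It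
    must have started before \<open>r\<close>, and its contiguous run then contains
    \<open>r\<close>.\<close>
  have lp_run_at_r: "r \<in> runs \<sigma> \<tau>' k' (Process j')"
    if lp: "\<tau>' \<in> lp \<Gamma> \<tau>" "j' \<in> accel_segs \<tau>'" "t \<in> runs \<sigma> \<tau>' k' (Process j')" "t \<in> ?W" for \<tau>' k' j' t
  proof -
    have "\<tau>' \<in> \<Gamma>" "\<tau> \<in> hp \<Gamma> \<tau>'" using lp(1) \<tau>(1) by (auto simp: lp_def hp_def)
    from this(1) lp(2) show ?thesis
    proof (cases rule: Process_run_cases[of \<tau>' j' k'])
      case (2 s)
      have "\<not> pending \<sigma> \<tau> k (Process j) s" using 2(3) \<open>\<tau> \<in> hp \<Gamma> \<tau>'\<close> \<tau>(2) by blast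
      then have "s < r" using pendW[of s] lp(3,4) 2(1) by force
      with lp(3,4) 2(1) show ?thesis by auto
    qed (use lp in auto)
  qed
  \<comment> \<open>By mutual exclusion at most one phase runs at \<open>r\<close>; its entire run
    set serves as \<open>A\<close>, or the empty set if no phase of lower priority runs
    there.\<close>
  obtain A where A: "A \<in> fmeasurable lebesgue" "measure lebesgue A \<le> blocking \<Gamma> \<tau>"
    and A_lp: "\<And>\<tau>' k' j'. \<tau>' \<in> lp \<Gamma> \<tau> \<Longrightarrow> j' \<in> accel_segs \<tau>' \<Longrightarrow>
      r \<in> runs \<sigma> \<tau>' k' (Process j') \<Longrightarrow> runs \<sigma> \<tau>' k' (Process j') \<subseteq> A"
  proof (cases "\<exists>\<tau>' k' j'. \<tau>' \<in> lp \<Gamma> \<tau> \<and> j' \<in> accel_segs \<tau>' \<and> r \<in> runs \<sigma> \<tau>' k' (Process j')")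
    case True
    then obtain \<tau>2 k2 j2 where 2: "\<tau>2 \<in> lp \<Gamma> \<tau>" "j2 \<in> accel_segs \<tau>2" "r \<in> runs \<sigma> \<tau>2 k2 (Process j2)"
      by blast
    then have "\<tau>2 \<in> \<Gamma>" by (simp add: lp_def)
    show thesis
    proof (rule that[of "runs \<sigma> \<tau>2 k2 (Process j2)"])
      show "runs \<sigma> \<tau>2 k2 (Process j2) \<in> fmeasurable lebesgue"
        using accel_runs_measure[OF \<open>\<tau>2 \<in> \<Gamma>\<close> 2(2)] by simp
      show "measure lebesgue (runs \<sigma> \<tau>2 k2 (Process j2)) \<le> blocking \<Gamma> \<tau>"
        using accel_runs_measure(2)[OF \<open>\<tau>2 \<in> \<Gamma>\<close> 2(2), of k2]
          accel_wcet_le_blocking[OF finite_tasks 2(1,2)] by simp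
      show "runs \<sigma> \<tau>' k' (Process j') \<subseteq> runs \<sigma> \<tau>2 k2 (Process j2)"
        if "\<tau>' \<in> lp \<Gamma> \<tau>" "j' \<in> accel_segs \<tau>'" "r \<in> runs \<sigma> \<tau>' k' (Process j')" for \<tau>' k' j'
        using Process_runs_disjoint[OF \<open>\<tau>2 \<in> \<Gamma>\<close> 2(2) _ that(2) 2(3) that(3)] that(1)
        by (simp add: lp_def)
    qed
  next
    case False
    with blocking_nonneg[OF task_system] show thesis by (intro that[of "{}"]) auto
  qed
  define J where "J h = {n. release \<sigma> h n < r + \<Phi> + d}" for h
  have JJ0: "J h \<subseteq> J0 h" for h using d(2) by (auto simp: J_def J0_def)
  have finJ: "finite (J h)" if "h \<in> hp \<Gamma> \<tau>" for h using finJ0[OF that] JJ0 finite_subset by blast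
  let ?V = "\<lambda>h n. accel_busy h n ?W"
  have V: "?V h n \<in> fmeasurable lebesgue" if "h \<in> hp \<Gamma> \<tau>" for h n
    using that hp_tasks by (intro accel_busy_lmeasurable) auto
  have UV: "(\<Union>n\<in>J h. ?V h n) \<in> fmeasurable lebesgue" if "h \<in> hp \<Gamma> \<tau>" for h
    using V[OF that] finJ[OF that] by (intro fmeasurable.finite_UN) auto
  have UUV: "(\<Union>h\<in>hp \<Gamma> \<tau>. \<Union>n\<in>J h. ?V h n) \<in> fmeasurable lebesgue"
    using V finJ hp_tasks(1) by (intro fmeasurable.finite_UN) auto
  have cover: "?W \<subseteq> A \<union> (\<Union>h\<in>hp \<Gamma> \<tau>. \<Union>n\<in>J h. ?V h n)"
  proof
    fix t assume t: "t \<in> ?W"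
    obtain \<tau>' k' j' where run: "\<tau>' \<in> \<Gamma>" "j' \<in> accel_segs \<tau>'" "t \<in> runs \<sigma> \<tau>' k' (Process j')"
      using pendW[OF t] by (rule accel_work_conserving[OF \<tau>])
    \<comment> \<open>A running phase of the same task would be pending and hence be the analysed
      phase, which does not run in the window.\<close>
    have "\<tau>' \<noteq> \<tau>"
    proof
      assume eq: "\<tau>' = \<tau>"
      from pending_Process_of_runs[OF run] pendW[OF t] have "k' = k \<and> Process j' = Process j"
        unfolding eq using run(2) \<tau> eq by (intro pending_unique[of \<tau>]) (auto simp: Process_in_phases)
      with run(3) not_run[of t] t eq show False by simp
    qed
    moreover have "inj_on prio \<Gamma>" using task_system by (simp add: task_system_def)
    ultimately have "prio \<tau>' \<noteq> prio \<tau>" using run(1) \<tau>(1) by (auto dest: inj_onD)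
    then have "\<tau>' \<in> lp \<Gamma> \<tau> \<or> \<tau>' \<in> hp \<Gamma> \<tau>"
      using run(1) by (auto simp: lp_def hp_def)
    then consider "\<tau>' \<in> lp \<Gamma> \<tau>" | "\<tau>' \<in> hp \<Gamma> \<tau>" by blast
    then show "t \<in> A \<union> (\<Union>h\<in>hp \<Gamma> \<tau>. \<Union>n\<in>J h. ?V h n)"
    proof cases
      case 1
      then show ?thesis using A_lp[OF 1 run(2) lp_run_at_r[OF 1 run(2,3) t]] run(3) by blast
    next
      case 2
      have "release \<sigma> \<tau>' k' \<le> t"
        using release_le_of_runs[OF run(1) _ run(3)] run(2) by (simp add: Process_in_phases)
      then have "k' \<in> J \<tau>'" using t by (auto simp: J_def)
      moreover have "t \<in> ?V \<tau>' k'" using run t by (auto simp: accel_busy_def)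
      ultimately show ?thesis using 2 by blast
    qed
  qed
  \<comment> \<open>Subadditivity over the cover and the workload bounds for length
    \<open>\<Phi>\<close> give the right-hand side of the fixed-point equation, so
    \<open>\<Phi> + d \<le> \<Phi>\<close>.\<close>
  have "\<Phi> + d = measure lebesgue ?W" using \<Phi>(1) d(1) by simp
  also have "\<dots> \<le> measure lebesgue (A \<union> (\<Union>h\<in>hp \<Gamma> \<tau>. \<Union>n\<in>J h. ?V h n))"
    using cover A UUV by (intro measure_mono_fmeasurable fmeasurable.Un) auto
  also have "\<dots> \<le> measure lebesgue A + measure lebesgue (\<Union>h\<in>hp \<Gamma> \<tau>. \<Union>n\<in>J h. ?V h n)"
    using A UUV by (intro measure_Un_le) (auto dest: fmeasurableD)
  also have "\<dots> \<le> blocking \<Gamma> \<tau> + (\<Sum>h\<in>hp \<Gamma> \<tau>. measure lebesgue (\<Union>n\<in>J h. ?V h n))"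
    using A(2) fmeasurableD[OF UV] hp_tasks(1) by (intro add_mono measure_UNION_le)
  also have "\<dots> \<le> blocking \<Gamma> \<tau> + (\<Sum>h\<in>hp \<Gamma> \<tau>. \<Sum>n\<in>J h. measure lebesgue (?V h n))"
    using V finJ by (intro add_left_mono sum_mono measure_UNION_le) (auto dest: fmeasurableD)
  also have "\<dots> \<le> blocking \<Gamma> \<tau> + (\<Sum>h\<in>hp \<Gamma> \<tau>.
      real_of_int \<lceil>(\<Phi> + deadline h - accel_demand h) / period h\<rceil> * accel_demand h)"
  proof (intro add_left_mono sum_mono)
    fix h assume h: "h \<in> hp \<Gamma> \<tau>"
    show "(\<Sum>n\<in>J h. measure lebesgue (?V h n))
      \<le> real_of_int \<lceil>(\<Phi> + deadline h - accel_demand h) / period h\<rceil> * accel_demand h"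
    proof (rule hp_workload_le)
      show "d \<le> actual \<sigma> h n (Offload v)" if "n \<in> J h" "v \<in> accel_segs h" for n v
        using dX[of "(h, n, v)"] that h JJ0 by auto
    qed (use h hp hp_tasks \<Phi>(1) d(1) J_def in auto)
  qed
  also have "\<dots> = \<Phi>" using \<Phi>(2) by simp
  finally show False using d(1) by simp
qed

text \<open>From any instant at which offloading is complete, processing waits at most
  \<open>\<Phi>\<close> and then runs without interruption for at most its WCET.\<close>

lemma suspension_duration_le:
  assumes \<tau>: "\<tau> \<in> \<Gamma>" "j \<in> accel_segs \<tau>" and fin: "finish_time \<sigma> \<tau> k (Offload j) < \<infinity>"
    and hp: "\<And>h. h \<in> hp \<Gamma> \<tau> \<Longrightarrow> wcrt \<Gamma> h \<le> ereal (deadline h)"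
      "\<And>h. h \<in> hp \<Gamma> \<tau> \<Longrightarrow> accel_demand h \<le> deadline h"
    and \<Phi>: "0 < \<Phi>" "\<Phi> = blocking \<Gamma> \<tau> + (\<Sum>h\<in>hp \<Gamma> \<tau>.
      real_of_int \<lceil>(\<Phi> + deadline h - accel_demand h) / period h\<rceil> * accel_demand h)"
  shows "region_duration \<sigma> \<tau> k (Suspension j) \<le> ereal (\<Phi> + accel_wcet \<tau> j)"
proof -
  let ?O = "finish_time \<sigma> \<tau> k (Offload j)" and ?P = "finish_time \<sigma> \<tau> k (Process j)"
  let ?S = "\<Phi> + accel_wcet \<tau> j"
  have ph: "Process j \<in> set (phases \<tau>)" using \<tau> by (simp add: Process_in_phases)
  have P_le: "?P \<le> ereal (r + ?S)" if r: "completed \<sigma> \<tau> k (Offload j) r" for r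
  proof -
    let ?a = "actual \<sigma> \<tau> k (Process j)"
    obtain s where s: "s \<le> r + \<Phi>" "runs \<sigma> \<tau> k (Process j) = {s..<s + ?a}"
      using Process_starts_within[OF \<tau> r hp \<Phi>] by blast
    have "{s..<s + ?a} \<inter> {..s + ?a} = {s..<s + ?a}" by auto
    then have "completed \<sigma> \<tau> k (Process j) (s + ?a)"
      using actual_pos[OF \<tau>(1) ph, of k] s by (simp add: completed_def)
    then have "?P \<le> ereal (s + ?a)" unfolding finish_time_def by (intro Inf_lower) blast
    also have "\<dots> \<le> ereal (r + ?S)" using s(1) actual_le_wcet[OF \<tau>(1) ph, of k] by simp
    finally show ?thesis .
  qed
  \<comment> \<open>Together with \<open>fin\<close>, this lower bound makes the offloading finish
    time a real number, so the difference of extended reals is meaningful.\<close>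
  have "ereal (release \<sigma> \<tau> k) \<le> ?O"
    unfolding finish_time_def
    using release_add_actual_le[OF \<tau>(1) Offload_in_phases[OF \<tau>(2)]]
      actual_pos[OF \<tau>(1) Offload_in_phases[OF \<tau>(2)], of k]
    by (intro Inf_greatest) force
  with fin obtain r where r: "?O = ereal r" by (cases ?O) auto
  \<comment> \<open>The infimum need not be attained, so it is approached from above by completion
    instants and \<open>e\<close> then tends to 0.\<close>
  have P_le_add: "?P \<le> ereal (r + ?S) + ereal e" if "0 < e" for e
  proof -
    have "?O < ereal (r + e)" using r that by simp
    then obtain t where "completed \<sigma> \<tau> k (Offload j) t" "t < r + e"
      unfolding finish_time_def by (auto simp: Inf_less_iff)
    with P_le[of t] have "?P \<le> ereal (t + ?S)" by simp
    also have "\<dots> \<le> ereal (r + ?S) + ereal e" using \<open>t < r + e\<close> by simp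
    finally show ?thesis .
  qed
  have "?P \<le> ereal (r + ?S)" by (rule ereal_le_epsilon2) (simp only: P_le_add)
  then show ?thesis by (simp add: r ereal_minus_le add.commute)
qed

end

theorem lemma2:
  fixes P :: "'p set" and \<Gamma> :: "'p task set" and \<tau> :: "'p task"
    and R :: "'p task \<Rightarrow> ereal" and j x k :: nat and \<Phi> S :: real and \<sigma> :: "'p schedule"
  assumes "task_system P \<Gamma>"
    and "\<And>\<tau>'. \<tau>' \<in> \<Gamma> \<Longrightarrow> wcrt \<Gamma> \<tau>' \<le> R \<tau>'"
    and "\<tau> \<in> \<Gamma>" and "j \<in> accel_segs \<tau>"
    and "x < length (ss_task \<tau>)" and "ss_task \<tau> ! x = Q_region j"
    and "\<And>h. h \<in> hp \<Gamma> \<tau> \<Longrightarrow> R h \<le> ereal (deadline h)"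
    and "least_positive_solution
           (\<lambda>\<phi>. \<phi> = blocking \<Gamma> \<tau> +
             (\<Sum>h\<in>hp \<Gamma> \<tau>.
                real_of_int \<lceil>(\<phi> + deadline h - accel_demand h) / period h\<rceil> * accel_demand h)) \<Phi>"
    and "S = \<Phi> + accel_wcet \<tau> j"
    and "legal \<Gamma> \<sigma>"
    and "finish_time \<sigma> \<tau> k (Offload j) < \<infinity>"  \<comment> \<open>job \<open>k\<close> reaches the suspension region\<close>
  shows "region_duration \<sigma> \<tau> k (ss_task \<tau> ! x) \<le> ereal S"
proof -
  interpret legal_schedule P \<Gamma> \<sigma> using assms(1,10) by unfold_locales
  have wcrt: "wcrt \<Gamma> h \<le> ereal (deadline h)" and "h \<in> \<Gamma>" if "h \<in> hp \<Gamma> \<tau>" for h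
    using that assms(2)[of h] assms(7)[of h] by (auto simp: hp_def)
  \<comment> \<open>The response time bounds also force each higher-priority demand to fit in its
    deadline, which the workload estimate requires.\<close>
  then have "accel_demand h \<le> deadline h" if "h \<in> hp \<Gamma> \<tau>" for h
    using accel_demand_le_deadline[OF assms(1)] that by blast
  then have "region_duration \<sigma> \<tau> k (Suspension j) \<le> ereal (\<Phi> + accel_wcet \<tau> j)"
    using assms(8) wcrt
    by (intro suspension_duration_le[OF assms(3,4,11)]) (auto simp: least_positive_solution_def)
  then show ?thesis by (simp add: assms(6,9) Q_region_def)
qed

end
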